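(* Let $\mathfrak{s}$ be a finite-dimensional complex semisimple Lie algebra, $V$ a nonzero finite-dimensional $\mathfrak{s}$-module, and $\mathfrak{g}=\mathfrak{s}\ltimes V$. Then, as vector spaces, $$H^1(\mathfrak{g},\mathfrak{g})\cong H^1(V,V)^{\mathfrak{s}}\cong\mathrm{Hom}_{\mathfrak{s}}(V,V).$$ In particular, $\dim H^1(\mathfrak{g},\mathfrak{g})\ge 1$ and $\mathfrak{g}$ is not complete.
   Context: $\mathfrak{s}\ltimes V$ is the semidirect product with $V$ considered as an abelian Lie algebra: the bracket on $\mathfrak{s}\oplus V$ is $[(x,v),(y,u)]=([x,y],x\cdot u-y\cdot v)$. $H^k$ denotes Chevalley–Eilenberg cohomology; in $H^1(\mathfrak{g},\mathfrak{g})$ the coefficients are the adjoint module, and in $H^1(V,V)$ the abelian Lie algebra $V$ acts trivially on $V$; $\mathfrak{s}$ acts on $H^1(V,V)$ in the usual way and $(\cdot)^{\mathfrak{s}}$ denotes $\mathfrak{s}$-invariants. A Lie algebra $\mathfrak{g}$ is complete if $Z(\mathfrak{g})=0$ and every derivation of $\mathfrak{g}$ is inner. *)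

theory Defs
  imports
    "HOL-Analysis.Product_Vector"
    "HOL-Library.Function_Algebras"
    "HOL-Library.Set_Algebras"
    "Jordan_Normal_Form.VS_Connect"
begin

section \<open>Lie algebras and modules\<close>

locale lie_algebra = vector_space scl
  for scl :: "'k::field \<Rightarrow> 'l::ab_group_add \<Rightarrow> 'l" +
  fixes bracket :: "'l \<Rightarrow> 'l \<Rightarrow> 'l"
  assumes bracket_linear_left: "Vector_Spaces.linear scl scl (\<lambda>x. bracket x y)"
    and bracket_linear_right: "Vector_Spaces.linear scl scl (bracket x)"
    and bracket_self: "bracket x x = 0"
    and jacobi: "bracket x (bracket y z) + bracket y (bracket z x) + bracket z (bracket x y) = 0"

locale lie_module = L: lie_algebra scaleL bracket + M: vector_space scaleM
  for scaleL :: "'k::field \<Rightarrow> 'l::ab_group_add \<Rightarrow> 'l"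
    and bracket :: "'l \<Rightarrow> 'l \<Rightarrow> 'l"
    and scaleM :: "'k \<Rightarrow> 'm::ab_group_add \<Rightarrow> 'm" +
  fixes act :: "'l \<Rightarrow> 'm \<Rightarrow> 'm"
  assumes act_linear_left: "Vector_Spaces.linear scaleL scaleM (\<lambda>x. act x m)"
    and act_linear_right: "Vector_Spaces.linear scaleM scaleM (act x)"
    and act_bracket: "act (bracket x y) m = act x (act y m) - act y (act x m)"

definition lie_ideal ::
  "('k::field \<Rightarrow> 'l::ab_group_add \<Rightarrow> 'l) \<Rightarrow> ('l \<Rightarrow> 'l \<Rightarrow> 'l) \<Rightarrow> 'l set \<Rightarrow> bool" where
  "lie_ideal scl bracket I \<longleftrightarrow>
     Modules.module.subspace scl I \<and> (\<forall>x. \<forall>y\<in>I. bracket x y \<in> I)"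

primrec derived_series ::
  "('k::field \<Rightarrow> 'l::ab_group_add \<Rightarrow> 'l) \<Rightarrow> ('l \<Rightarrow> 'l \<Rightarrow> 'l) \<Rightarrow> 'l set \<Rightarrow> nat \<Rightarrow> 'l set" where
  "derived_series scl bracket I 0 = I"
| "derived_series scl bracket I (Suc n) =
     Modules.module.span scl
       {bracket x y | x y. x \<in> derived_series scl bracket I n \<and> y \<in> derived_series scl bracket I n}"

definition lie_solvable ::
  "('k::field \<Rightarrow> 'l::ab_group_add \<Rightarrow> 'l) \<Rightarrow> ('l \<Rightarrow> 'l \<Rightarrow> 'l) \<Rightarrow> 'l set \<Rightarrow> bool" where
  "lie_solvable scl bracket I \<longleftrightarrow> (\<exists>n. derived_series scl bracket I n = {0})"

text \<open>Semisimple means that the solvable radical vanishes, i.e. the only solvable ideal is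
  zero. With this convention the zero Lie algebra is semisimple.\<close>

definition semisimple_lie_algebra ::
  "('k::field \<Rightarrow> 'l::ab_group_add \<Rightarrow> 'l) \<Rightarrow> ('l \<Rightarrow> 'l \<Rightarrow> 'l) \<Rightarrow> bool" where
  "semisimple_lie_algebra scl bracket \<longleftrightarrow>
     lie_algebra scl bracket \<and>
     (\<forall>I. lie_ideal scl bracket I \<and> lie_solvable scl bracket I \<longrightarrow> I = {0})"

definition lie_center :: "('l::ab_group_add \<Rightarrow> 'l \<Rightarrow> 'l) \<Rightarrow> 'l set" where
  "lie_center bracket = {x. \<forall>y. bracket x y = 0}"

definition derivation ::
  "('k::field \<Rightarrow> 'l::ab_group_add \<Rightarrow> 'l) \<Rightarrow> ('l \<Rightarrow> 'l \<Rightarrow> 'l) \<Rightarrow> ('l \<Rightarrow> 'l) \<Rightarrow> bool" where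
  "derivation scl bracket D \<longleftrightarrow>
     Vector_Spaces.linear scl scl D \<and>
     (\<forall>x y. D (bracket x y) = bracket (D x) y + bracket x (D y))"

definition complete_lie_algebra ::
  "('k::field \<Rightarrow> 'l::ab_group_add \<Rightarrow> 'l) \<Rightarrow> ('l \<Rightarrow> 'l \<Rightarrow> 'l) \<Rightarrow> bool" where
  "complete_lie_algebra scl bracket \<longleftrightarrow>
     lie_center bracket = {0} \<and>
     (\<forall>D. derivation scl bracket D \<longrightarrow> (\<exists>x. D = bracket x))"


section \<open>Semidirect products\<close>

abbreviation semidirect_scale ::
  "('k::field \<Rightarrow> 's::ab_group_add \<Rightarrow> 's) \<Rightarrow> ('k \<Rightarrow> 'v::ab_group_add \<Rightarrow> 'v) \<Rightarrow> 'k \<Rightarrow> 's \<times> 'v \<Rightarrow> 's \<times> 'v" where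
  "semidirect_scale scaleS scaleV \<equiv> module_prod.scale scaleS scaleV"

definition semidirect_bracket ::
  "('s \<Rightarrow> 's \<Rightarrow> 's) \<Rightarrow> ('s \<Rightarrow> 'v::ab_group_add \<Rightarrow> 'v) \<Rightarrow> 's \<times> 'v \<Rightarrow> 's \<times> 'v \<Rightarrow> 's \<times> 'v" where
  "semidirect_bracket bracket act = (\<lambda>(x, v) (y, u). (bracket x y, act x u - act y v))"


section \<open>Vector spaces on carrier sets\<close>

text \<open>Spaces that are not whole types are records over \<open>class_ring\<close>, the field of scalars as
  a ring record. The ring multiplication fields of the record play no role for modules.\<close>

definition subspace_record ::
  "('k::field \<Rightarrow> 'a::ab_group_add \<Rightarrow> 'a) \<Rightarrow> 'a set \<Rightarrow> ('k, 'a) module" where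
  "subspace_record scl U =
     \<lparr>carrier = U, mult = undefined, one = undefined, zero = 0, add = (+), smult = scl\<rparr>"

text \<open>The quotient \<open>U / W\<close>, whose elements are the cosets \<open>u + W\<close>; the sum of two cosets is
  their elementwise sum. In the scalar multiplication the summand \<open>W\<close> only matters for the
  scalar \<open>0\<close>, where the elementwise multiple of a coset is \<open>{0}\<close> instead of \<open>W\<close>.\<close>

definition quotient_record ::
  "('k::field \<Rightarrow> 'a::ab_group_add \<Rightarrow> 'a) \<Rightarrow> 'a set \<Rightarrow> 'a set \<Rightarrow> ('k, 'a set) module" where
  "quotient_record scl U W =
     \<lparr>carrier = (\<lambda>u. u +o W) ` U, mult = undefined, one = undefined, zero = W,
      add = (+), smult = (\<lambda>c A. scl c ` A + W)\<rparr>"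

definition vs_isomorphic ::
  "('k::field, 'a, 'c) module_scheme \<Rightarrow> ('k, 'b, 'd) module_scheme \<Rightarrow> bool" where
  "vs_isomorphic A B \<longleftrightarrow>
     (\<exists>\<phi>. linear_map class_ring A B \<phi> \<and> bij_betw \<phi> (carrier A) (carrier B))"


section \<open>First Chevalley--Eilenberg cohomology\<close>

text \<open>The complex of a Lie algebra with coefficients in a module \<open>M\<close> begins with
  \<open>M\<close>, the linear maps into \<open>M\<close>, and the alternating bilinear maps into \<open>M\<close>;
  \<open>ce_d0\<close> and \<open>ce_d1\<close> are its first two differentials.\<close>

definition ce_d0 :: "('l \<Rightarrow> 'm \<Rightarrow> 'm) \<Rightarrow> 'm \<Rightarrow> 'l \<Rightarrow> 'm" where
  "ce_d0 act m = (\<lambda>x. act x m)"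

definition ce_d1 ::
  "('l \<Rightarrow> 'l \<Rightarrow> 'l) \<Rightarrow> ('l \<Rightarrow> 'm::ab_group_add \<Rightarrow> 'm) \<Rightarrow> ('l \<Rightarrow> 'm) \<Rightarrow> 'l \<Rightarrow> 'l \<Rightarrow> 'm" where
  "ce_d1 bracket act f = (\<lambda>x y. act x (f y) - act y (f x) - f (bracket x y))"

definition ce_Z1 ::
  "('k::field \<Rightarrow> 'l::ab_group_add \<Rightarrow> 'l) \<Rightarrow> ('l \<Rightarrow> 'l \<Rightarrow> 'l) \<Rightarrow>
   ('k \<Rightarrow> 'm::ab_group_add \<Rightarrow> 'm) \<Rightarrow> ('l \<Rightarrow> 'm \<Rightarrow> 'm) \<Rightarrow> ('l \<Rightarrow> 'm) set" where
  "ce_Z1 scaleL bracket scaleM act =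
     {f. Vector_Spaces.linear scaleL scaleM f \<and> ce_d1 bracket act f = (\<lambda>x y. 0)}"

definition ce_B1 :: "('l \<Rightarrow> 'm \<Rightarrow> 'm) \<Rightarrow> ('l \<Rightarrow> 'm) set" where
  "ce_B1 act = range (ce_d0 act)"

definition fun_scale :: "('k \<Rightarrow> 'm \<Rightarrow> 'm) \<Rightarrow> 'k \<Rightarrow> ('l \<Rightarrow> 'm) \<Rightarrow> 'l \<Rightarrow> 'm" where
  "fun_scale scl = (\<lambda>c f x. scl c (f x))"

definition ce_H1 ::
  "('k::field \<Rightarrow> 'l::ab_group_add \<Rightarrow> 'l) \<Rightarrow> ('l \<Rightarrow> 'l \<Rightarrow> 'l) \<Rightarrow>
   ('k \<Rightarrow> 'm::ab_group_add \<Rightarrow> 'm) \<Rightarrow> ('l \<Rightarrow> 'm \<Rightarrow> 'm) \<Rightarrow> ('k, ('l \<Rightarrow> 'm) set) module" where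
  "ce_H1 scaleL bracket scaleM act =
     quotient_record (fun_scale scaleM) (ce_Z1 scaleL bracket scaleM act) (ce_B1 act)"

abbreviation H1_adjoint ::
  "('k::field \<Rightarrow> 'l::ab_group_add \<Rightarrow> 'l) \<Rightarrow> ('l \<Rightarrow> 'l \<Rightarrow> 'l) \<Rightarrow> ('k, ('l \<Rightarrow> 'l) set) module" where
  "H1_adjoint scl bracket \<equiv> ce_H1 scl bracket scl bracket"

abbreviation H1_abelian ::
  "('k::field \<Rightarrow> 'v::ab_group_add \<Rightarrow> 'v) \<Rightarrow> ('k, ('v \<Rightarrow> 'v) set) module" where
  "H1_abelian scl \<equiv> ce_H1 scl (\<lambda>v u. 0) scl (\<lambda>v u. 0)"

text \<open>An element \<open>x\<close> of \<open>s\<close> acts on a 1-cochain \<open>f\<close> of \<open>V\<close> with values in \<open>V\<close> by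
  \<open>(x \<cdot> f) v = x \<cdot> f v - f (x \<cdot> v)\<close>, and on a cohomology class through any representative;
  below the class is moved elementwise and then saturated to a full coset.\<close>

definition cochain_act ::
  "('s \<Rightarrow> 'v::ab_group_add \<Rightarrow> 'v) \<Rightarrow> 's \<Rightarrow> ('v \<Rightarrow> 'v) \<Rightarrow> 'v \<Rightarrow> 'v" where
  "cochain_act act x f = (\<lambda>v. act x (f v) - f (act x v))"

definition H1_abelian_act ::
  "('s \<Rightarrow> 'v::ab_group_add \<Rightarrow> 'v) \<Rightarrow> 's \<Rightarrow> ('v \<Rightarrow> 'v) set \<Rightarrow> ('v \<Rightarrow> 'v) set" where
  "H1_abelian_act act x A = cochain_act act x ` A + ce_B1 (\<lambda>(v::'v) (u::'v). 0)"

definition H1_abelian_invariants ::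
  "('k::field \<Rightarrow> 'v::ab_group_add \<Rightarrow> 'v) \<Rightarrow> ('s \<Rightarrow> 'v \<Rightarrow> 'v) \<Rightarrow> ('k, ('v \<Rightarrow> 'v) set) module" where
  "H1_abelian_invariants scaleV act =
     (H1_abelian scaleV)
       \<lparr>carrier := {A \<in> carrier (H1_abelian scaleV).
                     \<forall>x. H1_abelian_act act x A = zero (H1_abelian scaleV)}\<rparr>"

definition module_endomorphisms ::
  "('k::field \<Rightarrow> 'v::ab_group_add \<Rightarrow> 'v) \<Rightarrow> ('s \<Rightarrow> 'v \<Rightarrow> 'v) \<Rightarrow> ('k, 'v \<Rightarrow> 'v) module" where
  "module_endomorphisms scaleV act =
     subspace_record (fun_scale scaleV)
       {f. Vector_Spaces.linear scaleV scaleV f \<and> (\<forall>x v. f (act x v) = act x (f v))}"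


section \<open>Consistency of the constructions\<close>

context lie_algebra
begin

lemma bracket_add:
  "bracket (a + b) c = bracket a c + bracket b c" "bracket a (b + c) = bracket a b + bracket a c"
  using bracket_linear_left[of c] bracket_linear_right[of a] by (simp_all add: Vector_Spaces.linear_iff)

lemma bracket_scale:
  "bracket (scl k a) c = scl k (bracket a c)" "bracket a (scl k c) = scl k (bracket a c)"
  using bracket_linear_left[of c] bracket_linear_right[of a] by (simp_all add: Vector_Spaces.linear_iff)

lemma bracket_anti: "bracket x y = - bracket y x"
proof -
  have "bracket (x + y) (x + y) = 0" by (rule bracket_self)
  then have "bracket x y + bracket y x = 0" using bracket_add(1)[of x y "x + y"] bracket_add(2) bracket_self by simp
  then show ?thesis by (simp add: eq_neg_iff_add_eq_0)
qed

lemma bracket_neg: "bracket x (- y) = - bracket x y"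
  using bracket_add(2)[of x y "- y"] bracket_scale(2)[of x 0 0]
  by (simp add: eq_neg_iff_add_eq_0 add.commute)

lemma adjoint_lie_module: "lie_module scl bracket scl bracket"
proof (rule lie_module.intro[OF lie_algebra_axioms vector_space_axioms], rule lie_module_axioms.intro)
  fix x y m
  have "bracket x (bracket y m) + bracket y (bracket m x) + bracket m (bracket x y) = 0"
    by (rule jacobi)
  moreover have "bracket y (bracket m x) = - bracket y (bracket x m)"
    using bracket_anti[of m x] bracket_neg by simp
  moreover have "bracket m (bracket x y) = - bracket (bracket x y) m"
    by (rule bracket_anti)
  ultimately show "bracket (bracket x y) m = bracket x (bracket y m) - bracket y (bracket x m)"
    by (simp add: algebra_simps)
qed (rule bracket_linear_left bracket_linear_right)+

end

lemma abelian_lie_algebra: "vector_space scl \<Longrightarrow> lie_algebra scl (\<lambda>x y. 0)"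
  by (rule lie_algebra.intro, assumption, rule lie_algebra_axioms.intro)
    (auto simp: Vector_Spaces.linear_iff vector_space.vector_space_assms(1) module.scale_zero_right
      module_iff_vector_space)

lemma abelian_trivial_module:
  "vector_space scl \<Longrightarrow> lie_module scl (\<lambda>x y. 0) scl (\<lambda>x y. 0)"
  by (rule lie_module.intro[OF abelian_lie_algebra], assumption, assumption,
      rule lie_module_axioms.intro)
    (auto simp: Vector_Spaces.linear_iff module.scale_zero_right module_iff_vector_space)

lemma (in lie_module) semidirect_lie_algebra:
  "lie_algebra (semidirect_scale scaleL scaleM) (semidirect_bracket bracket act)"
proof -
  interpret P: vector_space_prod scaleL scaleM by unfold_locales
  have a: "act (x + y) m = act x m + act y m" "act (scaleL k x) m = scaleM k (act x m)"
    "act x (m + n) = act x m + act x n" "act x (scaleM k m) = scaleM k (act x m)" for x y m n k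
    using act_linear_left[of m] act_linear_right[of x] by (simp_all add: Vector_Spaces.linear_iff)
  have d: "act x (m - n) = act x m - act x n" for x m n
    using a(3)[of x "m - n" n] by (simp add: algebra_simps)
  have z: "act x 0 = 0" for x
    using d[of x 0 0] by simp
  show ?thesis
  proof (rule lie_algebra.intro[OF P.p.vector_space_axioms], rule lie_algebra_axioms.intro)
    fix x y z :: "'l \<times> 'm"
    show "Vector_Spaces.linear P.scale P.scale (\<lambda>x. semidirect_bracket bracket act x y)"
      by (auto simp: Vector_Spaces.linear_iff P.p.vector_space_axioms semidirect_bracket_def
          P.scale_def a L.bracket_add L.bracket_scale M.scale_right_diff_distrib split: prod.splits)
    show "Vector_Spaces.linear P.scale P.scale (semidirect_bracket bracket act x)"
      by (auto simp: Vector_Spaces.linear_iff P.p.vector_space_axioms semidirect_bracket_def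
          P.scale_def a L.bracket_add L.bracket_scale M.scale_right_diff_distrib split: prod.splits)
    show "semidirect_bracket bracket act x x = 0"
      by (auto simp: semidirect_bracket_def L.bracket_self zero_prod_def split: prod.splits)
    show "semidirect_bracket bracket act x (semidirect_bracket bracket act y z) +
      semidirect_bracket bracket act y (semidirect_bracket bracket act z x) +
      semidirect_bracket bracket act z (semidirect_bracket bracket act x y) = 0"
      by (auto simp: semidirect_bracket_def L.jacobi act_bracket d zero_prod_def
          split: prod.splits)
  qed
qed

lemma (in vector_space) quotient_record_vectorspace:
  assumes U: "subspace U" and W: "subspace W" and WU: "W \<subseteq> U"
  shows "vectorspace class_ring (quotient_record scale U W)"
proof -
  let ?Q = "quotient_record scale U W"
  have WW: "W + W = W"
  proof (rule equalityI[OF _ subsetI])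
    show "W + W \<subseteq> W" using subspace_add[OF W] by (auto simp: set_plus_def)
    show "x \<in> W + W" if "x \<in> W" for x
      using that subspace_0[OF W] set_plus_intro[of x W 0 W] by simp
  qed
  have coset: "u +o W = {u} + W" for u by (auto simp: elt_set_plus_def set_plus_def)
  have add: "(u +o W) + (v +o W) = (u + v) +o W" for u v
  proof -
    have "(u +o W) + (v +o W) = ({u} + {v}) + (W + W)" by (simp only: coset ac_simps)
    also have "{u} + {v} = {u + v}" by (simp add: set_plus_def)
    finally show ?thesis by (simp only: WW coset)
  qed
  have smult: "scale c ` (u +o W) + W = scale c u +o W" for c u
  proof (intro equalityI subsetI)
    fix x assume "x \<in> scale c ` (u +o W) + W"
    then obtain w w' where "w \<in> W" "w' \<in> W" "x = scale c (u + w) + w'"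
      by (auto simp: elt_set_plus_def set_plus_def)
    then show "x \<in> scale c u +o W"
      using subspace_add[OF W subspace_scale[OF W]]
      by (auto simp: elt_set_plus_def scale_right_distrib add.assoc)
  next
    fix x assume "x \<in> scale c u +o W"
    then obtain w where w: "w \<in> W" "x = scale c (u + 0) + w" by (auto simp: elt_set_plus_def)
    then show "x \<in> scale c ` (u +o W) + W"
      using subspace_0[OF W] by (fastforce simp: elt_set_plus_def set_plus_def)
  qed
  have smult_sum: "(\<lambda>x. scale a x + scale b x) ` (u +o W) + W = (scale a u + scale b u) +o W" for a b u
    using smult[of "a + b" u] by (simp add: scale_left_distrib)
  have smult_one: "(u +o W) + W = u +o W" for u
    using smult[of 1 u] by simp
  have W0: "W = 0 +o W" by (simp add: elt_set_plus_def)
  have zero: "W + (u +o W) = u +o W" for u using add[of 0 u] W0 by simp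
  have grp: "abelian_group ?Q"
  proof (rule abelian_groupI)
    show "\<zero>\<^bsub>?Q\<^esub> \<in> carrier ?Q"
      using W0 subspace_0[OF U] by (force simp: quotient_record_def)
    show "\<exists>y\<in>carrier ?Q. y \<oplus>\<^bsub>?Q\<^esub> x = \<zero>\<^bsub>?Q\<^esub>" if x: "x \<in> carrier ?Q" for x
    proof -
      obtain u where u: "u \<in> U" "x = u +o W" using x by (auto simp: quotient_record_def)
      then have "(- u +o W) + x = W" using add[of "- u" u] W0 by simp
      then show ?thesis using u subspace_neg[OF U] by (force simp: quotient_record_def)
    qed
  qed (use subspace_add[OF U] in \<open>auto simp: quotient_record_def add zero ac_simps\<close>)
  have "Module.module class_ring ?Q"
  proof (rule Module.module.intro)
    show "cring (class_ring :: 'a ring)" by unfold_locales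
    show "abelian_group ?Q" by (rule grp)
    show "module_axioms class_ring ?Q"
      by (rule module_axioms.intro)
        (use subspace_scale[OF U] in
          \<open>auto simp: quotient_record_def add smult smult_sum smult_one scale_left_distrib scale_right_distrib\<close>)
  qed
  moreover have "field (class_ring :: 'a ring)" by unfold_locales
  ultimately show ?thesis by (rule vectorspace.intro)
qed

lemma (in lie_module) ce_H1_vectorspace:
  "vectorspace class_ring (ce_H1 scaleL bracket scaleM act)"
proof -
  interpret F: vector_space "fun_scale scaleM :: 'k \<Rightarrow> ('l \<Rightarrow> 'm) \<Rightarrow> 'l \<Rightarrow> 'm"
    by unfold_locales
      (auto simp: fun_scale_def fun_eq_iff M.scale_right_distrib M.scale_left_distrib)
  have a: "act (x + y) m = act x m + act y m" "act (scaleL k x) m = scaleM k (act x m)"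
    "act x (m + n) = act x m + act x n" "act x (scaleM k m) = scaleM k (act x m)" for x y m n k
    using act_linear_left[of m] act_linear_right[of x] by (simp_all add: Vector_Spaces.linear_iff)
  have z: "act x 0 = 0" for x
    using a(3)[of x 0 0] by simp
  have "F.subspace (ce_Z1 scaleL bracket scaleM act)"
  proof (rule F.subspaceI)
    show "0 \<in> ce_Z1 scaleL bracket scaleM act"
      by (simp add: ce_Z1_def ce_d1_def Vector_Spaces.linear_iff z fun_eq_iff
          L.vector_space_axioms M.vector_space_axioms)
  next
    fix f g assume fg: "f \<in> ce_Z1 scaleL bracket scaleM act" "g \<in> ce_Z1 scaleL bracket scaleM act"
    then have "ce_d1 bracket act (f + g) x y = 0" for x y
    proof -
      have "ce_d1 bracket act (f + g) x y = ce_d1 bracket act f x y + ce_d1 bracket act g x y"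
        by (simp add: ce_d1_def a)
      then show ?thesis using fg by (simp add: ce_Z1_def)
    qed
    moreover have "Vector_Spaces.linear scaleL scaleM (f + g)"
      using fg by (simp add: ce_Z1_def Vector_Spaces.linear_iff M.scale_right_distrib)
    ultimately show "f + g \<in> ce_Z1 scaleL bracket scaleM act"
      by (simp add: ce_Z1_def fun_eq_iff)
  next
    fix c f assume f: "f \<in> ce_Z1 scaleL bracket scaleM act"
    then have "ce_d1 bracket act (fun_scale scaleM c f) x y = 0" for x y
    proof -
      have "ce_d1 bracket act (fun_scale scaleM c f) x y = scaleM c (ce_d1 bracket act f x y)"
        by (simp add: ce_d1_def fun_scale_def a M.scale_right_diff_distrib)
      then show ?thesis using f by (simp add: ce_Z1_def)
    qed
    moreover have "Vector_Spaces.linear scaleL scaleM (fun_scale scaleM c f)"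
      using f by (simp add: ce_Z1_def fun_scale_def Vector_Spaces.linear_iff
          M.scale_right_distrib mult.commute)
    ultimately show "fun_scale scaleM c f \<in> ce_Z1 scaleL bracket scaleM act"
      by (simp add: ce_Z1_def fun_eq_iff)
  qed
  moreover have "F.subspace (ce_B1 act :: ('l \<Rightarrow> 'm) set)"
  proof (rule F.subspaceI)
    show "0 \<in> ce_B1 act"
      unfolding ce_B1_def ce_d0_def by (rule range_eqI[of _ _ 0]) (simp add: fun_eq_iff z)
    show "f + g \<in> ce_B1 act" if fg: "f \<in> ce_B1 act" "g \<in> ce_B1 act" for f g
    proof -
      obtain m n where "f = ce_d0 act m" "g = ce_d0 act n" using fg by (auto simp: ce_B1_def)
      then have "f + g = ce_d0 act (m + n)" by (simp add: ce_d0_def fun_eq_iff a)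
      then show ?thesis by (simp add: ce_B1_def)
    qed
    show "fun_scale scaleM c f \<in> ce_B1 act" if f: "f \<in> ce_B1 act" for c f
    proof -
      obtain m where "f = ce_d0 act m" using f by (auto simp: ce_B1_def)
      then have "fun_scale scaleM c f = ce_d0 act (scaleM c m)"
        by (simp add: ce_d0_def fun_scale_def fun_eq_iff a)
      then show ?thesis by (simp add: ce_B1_def)
    qed
  qed
  moreover have "ce_B1 act \<subseteq> ce_Z1 scaleL bracket scaleM act"
    using act_linear_left by (auto simp: ce_B1_def ce_Z1_def ce_d0_def ce_d1_def act_bracket)
  ultimately show ?thesis
    unfolding ce_H1_def by (rule F.quotient_record_vectorspace)
qed

end

theory Submission
  imports
    Defs
    "HOL-Computational_Algebra.Fundamental_Theorem_Algebra"
    "HOL-Computational_Algebra.Field_as_Ring"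
    "HOL-Computational_Algebra.Polynomial_Factorial"
begin

text \<open>Write a derivation of \<open>s \<ltimes> V\<close> as a block matrix with entries \<open>\<alpha>: s \<rightarrow> s\<close>, \<open>\<beta>: s \<rightarrow> V\<close>,
  \<open>\<gamma>: V \<rightarrow> s\<close>, \<open>\<delta>: V \<rightarrow> V\<close>. The image of \<open>\<gamma>\<close> is an abelian ideal, hence zero, while \<open>\<alpha>\<close> and \<open>\<beta>\<close> are
  1-cocycles, hence coboundaries by Whitehead's first lemma. Subtracting an inner derivation
  leaves an equivariant endomorphism of \<open>V\<close>, and it is determined because the centre of \<open>s\<close> is zero.

  Since semisimple means that the radical vanishes, Whitehead's lemma needs Cartan's criterion:
  if the trace form vanishes on an ideal, its derived ideal acts by nilpotent operators (pair \<open>x\<close>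
  with the operator that has the complex conjugate eigenvalues) and Engel's theorem applies. Hence ideals
  are perfect, and the null space of a trace form acts trivially. The Casimir operator of the trace
  form then splits off the part of the module on which it is invertible, where a cocycle is
  visibly a coboundary; this part is nonzero unless the action is trivial, because the trace of
  the Casimir operator is the rank of the form.\<close>

section \<open>Polynomials in an operator\<close>

text \<open>Whitehead's lemma is used twice, with the adjoint module for \<alpha> and with
  \<open>V\<close> for \<beta>. Since \<open>V\<close> need be neither faithful nor irreducible, the
  Casimir operator is built modulo the null space of the trace form. Nothing is lost there: the null
  space acts trivially, and being perfect it is also killed by every cocycle. Reduction to
  irreducible modules is replaced by the Fitting decomposition of the Casimir operator. Spaces are
  whole types with a fixed basis, so the arguments are arranged to avoid submodules and quotient
  modules. Engel's theorem is proved with a filtration instead of a null vector in a quotient, and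
  projections are polynomials in an operator, so they commute with whatever commutes with it. The
  complex numbers supply the roots of annihilating polynomials, the square roots that normalise
  vectors for a symmetric form, and conjugation. The last makes the decisive trace a sum of
  nonnegative reals and replaces the usual choice of rational linear functionals on the span of the
  eigenvalues.\<close>

locale operators = vector_space scale
  for scale :: "'a::field \<Rightarrow> 'b::ab_group_add \<Rightarrow> 'b" (infixr \<open>*s\<close> 75)
begin

abbreviation endo :: "('b \<Rightarrow> 'b) \<Rightarrow> bool" where
  "endo \<equiv> Vector_Spaces.linear scale scale"

lemma endoI:
  "(\<And>x y. f (x + y) = f x + f y) \<Longrightarrow> (\<And>c x. f (scale c x) = scale c (f x)) \<Longrightarrow> endo f"
  by (simp add: Vector_Spaces.linear_iff vector_space_axioms)

lemma endo_add: "endo f \<Longrightarrow> f (x + y) = f x + f y"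
  and endo_scale: "endo f \<Longrightarrow> f (scale c x) = scale c (f x)"
  by (simp_all add: Vector_Spaces.linear_iff)

lemma endo_hom: "endo f \<Longrightarrow> Modules.module_hom scale scale f"
  by (rule Vector_Spaces.linear.axioms(3))

lemmas endo_zero = Modules.module_hom.zero[OF endo_hom]
  and endo_diff = Modules.module_hom.diff[OF endo_hom]
  and endo_sum = Modules.module_hom.sum[OF endo_hom]

lemma endo_id: "endo (\<lambda>v. v)"
  by (rule endoI) auto

lemma endo_comp: "endo f \<Longrightarrow> endo g \<Longrightarrow> endo (\<lambda>v. f (g v))"
  by (rule endoI) (simp_all add: endo_add endo_scale)

lemma endo_plus: "endo f \<Longrightarrow> endo g \<Longrightarrow> endo (\<lambda>v. f v + g v)"
  by (rule endoI) (simp_all add: endo_add endo_scale scale_right_distrib)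

lemma endo_minus: "endo f \<Longrightarrow> endo g \<Longrightarrow> endo (\<lambda>v. f v - g v)"
  by (rule endoI) (simp_all add: endo_add endo_scale scale_right_diff_distrib)

lemma endo_cmult: "endo f \<Longrightarrow> endo (\<lambda>v. scale c (f v))"
  by (rule endoI) (simp_all add: endo_add endo_scale scale_right_distrib mult.commute)

lemma endo_zero_map: "endo (\<lambda>v. 0)"
  by (rule endoI) auto

lemma endo_sum_map: "(\<And>i. i \<in> A \<Longrightarrow> endo (f i)) \<Longrightarrow> endo (\<lambda>v. \<Sum>i\<in>A. f i v)"
  by (induction A rule: infinite_finite_induct) (auto simp: endo_zero_map intro: endo_plus)

lemma endo_funpow: "endo f \<Longrightarrow> endo (f ^^ n)"
  by (induction n) (auto simp: endo_comp o_def id_def intro: endo_id)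

definition poly_op :: "'a poly \<Rightarrow> ('b \<Rightarrow> 'b) \<Rightarrow> 'b \<Rightarrow> 'b" where
  "poly_op p f v = (\<Sum>i\<le>degree p. scale (coeff p i) ((f ^^ i) v))"

lemma poly_op_altdef:
  assumes "degree p \<le> n"
  shows "poly_op p f v = (\<Sum>i\<le>n. scale (coeff p i) ((f ^^ i) v))"
  unfolding poly_op_def
  by (rule sum.mono_neutral_left) (use assms in \<open>auto simp: coeff_eq_0\<close>)

lemma poly_op_0 [simp]: "poly_op 0 f v = 0"
  and poly_op_1 [simp]: "poly_op 1 f v = v"
  by (simp_all add: poly_op_def)

lemma poly_op_add: "poly_op (p + q) f v = poly_op p f v + poly_op q f v"
proof -
  let ?n = "max (degree p) (degree q)"
  show ?thesis
    using poly_op_altdef[of "p + q" ?n] poly_op_altdef[of p ?n] poly_op_altdef[of q ?n]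
      degree_add_le_max[of p q]
    by (simp add: scale_left_distrib sum.distrib)
qed

lemma poly_op_smult: "poly_op (Polynomial.smult c p) f v = scale c (poly_op p f v)"
  using poly_op_altdef[OF degree_smult_le[of c p]] by (simp add: poly_op_def scale_sum_right)

lemma poly_op_diff: "poly_op (p - q) f v = poly_op p f v - poly_op q f v"
  using poly_op_add[of "p - q" q f v] by (simp add: algebra_simps)

lemma poly_op_pCons:
  assumes "endo f"
  shows "poly_op (pCons a p) f v = scale a v + f (poly_op p f v)"
proof -
  have "poly_op (pCons a p) f v = (\<Sum>i\<le>Suc (degree p). scale (coeff (pCons a p) i) ((f ^^ i) v))"
    by (rule poly_op_altdef) (rule degree_pCons_le)
  also have "\<dots> = scale a v + (\<Sum>i\<le>degree p. scale (coeff p i) (f ((f ^^ i) v)))"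
    by (simp only: sum.atMost_Suc_shift) simp
  finally show ?thesis
    by (simp add: poly_op_def endo_sum[OF assms] endo_scale[OF assms])
qed

lemma poly_op_mult:
  assumes "endo f"
  shows "poly_op (p * q) f v = poly_op p f (poly_op q f v)"
proof (induction p)
  case (pCons a p)
  then show ?case
    by (simp add: poly_op_add poly_op_smult poly_op_pCons[OF assms])
qed simp

lemma poly_op_monom: "poly_op (Polynomial.monom 1 n) f v = (f ^^ n) v"
  using poly_op_altdef[OF order_refl, of "Polynomial.monom 1 n" f v]
  by (simp add: degree_monom_eq if_distrib[of "\<lambda>c. scale c _"] sum.delta cong: if_cong)

lemma endo_poly_op: "endo f \<Longrightarrow> endo (poly_op p f)"
proof (induction p)
  case 0
  then show ?case using endo_zero_map by (simp add: poly_op_def[abs_def])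
next
  case (pCons a p)
  have "poly_op (pCons a p) f = (\<lambda>v. scale a v + f (poly_op p f v))"
    using pCons by (simp add: fun_eq_iff poly_op_pCons)
  then show ?case using endo_plus[OF endo_cmult[OF endo_id] endo_comp] pCons by simp
qed

lemma poly_op_commute:
  assumes "endo f" "endo g" "\<And>v. g (f v) = f (g v)"
  shows "g (poly_op p f v) = poly_op p f (g v)"
  by (induction p) (simp_all add: poly_op_pCons assms endo_add endo_scale endo_zero)

lemma poly_op_subspace:
  assumes "endo f" "subspace S" "\<And>v. v \<in> S \<Longrightarrow> f v \<in> S" "v \<in> S"
  shows "poly_op p f v \<in> S"
  by (induction p) (simp_all add: poly_op_pCons assms subspace_0 subspace_add subspace_scale)

lemma poly_op_linear_power:
  assumes "endo f"
  shows "poly_op ([:- a, 1:] ^ n) f v = ((\<lambda>v. f v - scale a v) ^^ n) v"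
  by (induction n)
    (simp_all only: power.simps poly_op_mult[OF assms], simp_all add: poly_op_pCons assms endo_zero)

text \<open>The bound is on the coefficients rather than on the degree because for
  \<open>k = 0\<close> only the zero polynomial qualifies, and its degree is not below 0.\<close>

lemma span_powers_poly_op:
  assumes "endo f" "w \<in> span {(f ^^ i) v | i. i < k}"
  shows "\<exists>q. (\<forall>i\<ge>k. coeff q i = 0) \<and> w = poly_op q f v"
proof -
  let ?S = "{w. \<exists>q. (\<forall>i\<ge>k. coeff q i = 0) \<and> w = poly_op q f v}"
  have "x \<in> ?S" if "x \<in> {(f ^^ i) v | i. i < k}" for x
  proof -
    from that obtain i where "i < k" "x = (f ^^ i) v" by auto
    then show ?thesis
      by (auto intro!: exI[of _ "Polynomial.monom 1 i"] simp: poly_op_monom)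
  qed
  moreover have "subspace ?S"
  proof (rule subspaceI)
    show "0 \<in> ?S"
      by (auto intro!: exI[of _ 0])
  next
    fix x y assume "x \<in> ?S"
      "y \<in> ?S"
    then obtain p q where "\<forall>i\<ge>k. coeff p i = 0" "x = poly_op p f v"
      "\<forall>i\<ge>k. coeff q i = 0" "y = poly_op q f v" by auto
    then show "x + y \<in> ?S"
      by (auto intro!: exI[of _ "p + q"] simp: poly_op_add)
  next
    fix c x assume "x \<in> ?S"
    then obtain p where "\<forall>i\<ge>k. coeff p i = 0" "x = poly_op p f v" by auto
    then show "scale c x \<in> ?S"
      by (auto intro!: exI[of _ "Polynomial.smult c p"] simp: poly_op_smult)
  qed
  ultimately have "span {(f ^^ i) v | i. i < k} \<subseteq> ?S"
    by (intro span_minimal subsetI)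
  then show ?thesis using assms(2) by blast
qed

end

locale fd_operators = operators scale + finite_dimensional_vector_space scale Basis
  for scale :: "'a::field \<Rightarrow> 'b::ab_group_add \<Rightarrow> 'b" (infixr \<open>*s\<close> 75) and Basis
begin

text \<open>The iterates of \<open>v\<close> cannot stay independent beyond the dimension. An
  iterate \<open>(f ^^ k) v\<close> in the span of its predecessors gives the polynomial X^k - q,
  whose coefficient at \<open>k\<close> is 1.\<close>

lemma annihilator_vector:
  assumes "endo f"
  shows "\<exists>p. p \<noteq> 0 \<and> poly_op p f v = 0"
proof -
  have "\<exists>k. (f ^^ k) v \<in> span {(f ^^ i) v | i. i < k}"
  proof (rule ccontr)
    assume no: "\<not> ?thesis"
    define S where "S = (\<lambda>k. {(f ^^ i) v | i. i < k})"
    have S0: "S 0 = {}" by (simp add: S_def)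
    have S_Suc: "S (Suc k) = insert ((f ^^ k) v) (S k)" for k
      by (auto simp: S_def less_Suc_eq)
    have notin: "(f ^^ k) v \<notin> span (S k)" for k
      unfolding S_def by (rule contrapos_nn[OF no]) (rule exI)
    have ind: "finite (S k) \<and> independent (S k) \<and> card (S k) = k" for k
    proof (induction k)
      case (Suc k)
      have "(f ^^ k) v \<notin> S k" by (rule contrapos_nn[OF notin]) (rule span_base)
      then show ?case using Suc notin[of k] by (simp add: S_Suc independent_insert)
    qed (simp add: S0 independent_empty)
    from ind[of "Suc dimension"] show False
      using dim_subset_UNIV[of "S (Suc dimension)"] dim_eq_card_independent[of "S (Suc dimension)"]
      by simp
  qed
  then obtain k q where "\<forall>i\<ge>k. coeff q i = 0" "(f ^^ k) v = poly_op q f v"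
    using span_powers_poly_op[OF assms] by (elim exE) blast
  then have "coeff (Polynomial.monom 1 k - q) k = 1"
    "poly_op (Polynomial.monom 1 k - q) f v = 0"
    by (simp_all add: poly_op_diff poly_op_monom)
  then show ?thesis by (intro exI[of _ "Polynomial.monom 1 k - q"]) auto
qed

text \<open>Multiply annihilators of the basis vectors. The factors commute, so the one belonging to
  a given basis vector can be applied first.\<close>

lemma annihilator_exists:
  assumes f: "endo f"
  obtains p where "p \<noteq> 0" "\<And>v. poly_op p f v = 0"
proof -
  obtain P where P: "\<And>v. P v \<noteq> 0" "\<And>v. poly_op (P v) f v = 0"
    using annihilator_vector[OF f] by metis
  define p where "p = (\<Prod>b\<in>Basis. P b)"
  have "p \<noteq> 0" using P finite_Basis by (simp add: p_def)
  moreover have "poly_op p f v = 0" for v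
  proof -
    have "b \<in> {v. poly_op p f v = 0}" if "b \<in> Basis" for b
    proof -
      have "p = (\<Prod>b\<in>Basis - {b}. P b) * P b"
        using that finite_Basis by (simp add: p_def prod.remove mult.commute)
      then show ?thesis by (simp add: poly_op_mult[OF f] P endo_zero[OF endo_poly_op[OF f]])
    qed
    moreover have "subspace {v. poly_op p f v = 0}"
      by (rule subspaceI)
          (simp_all add: endo_zero endo_add endo_scale endo_poly_op f)
    ultimately have "span Basis \<subseteq> {v. poly_op p f v = 0}" by (intro span_minimal subsetI)
    then show ?thesis by (auto simp: span_Basis)
  qed
  ultimately show ?thesis by (rule that)
qed

section \<open>Traces\<close>

text \<open>Computed in the fixed \<open>Basis\<close>. Expansions in other sets of vectors are
  evaluated by \<open>trace_rank_one\<close>, so that no change of basis occurs.\<close>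

definition trace :: "('b \<Rightarrow> 'b) \<Rightarrow> 'a" where
  "trace f = (\<Sum>b\<in>Basis. representation Basis (f b) b)"

lemma rep_simps:
  "representation Basis (u + v) b = representation Basis u b + representation Basis v b"
  "representation Basis (scale c u) b = c * representation Basis u b"
  "representation Basis (u - v) b = representation Basis u b - representation Basis v b"
  "representation Basis 0 b = 0"
  by (simp_all add: representation_add representation_scale representation_diff
      representation_zero independent_Basis span_Basis)

lemma rep_expand: "(\<Sum>b\<in>Basis. scale (representation Basis v b) b) = v"
  by (rule sum_representation_eq) (auto simp: independent_Basis span_Basis finite_Basis)

lemma trace_add: "trace (\<lambda>v. f v + g v) = trace f + trace g"
  and trace_diff: "trace (\<lambda>v. f v - g v) = trace f - trace g"
  and trace_cmult: "trace (\<lambda>v. scale c (f v)) = c * trace f"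
  and trace_0 [simp]: "trace (\<lambda>v. 0) = 0"
  by (simp_all add: trace_def rep_simps sum.distrib sum_subtractf sum_distrib_left)

lemma trace_sum: "trace (\<lambda>v. \<Sum>i\<in>A. f i v) = (\<Sum>i\<in>A. trace (f i))"
  by (induction A rule: infinite_finite_induct) (simp_all add: trace_add)

lemma trace_rank_one:
  assumes "Vector_Spaces.linear scale (*) \<phi>"
  shows "trace (\<lambda>v. scale (\<phi> v) u) = \<phi> u"
proof -
  have "\<phi> u = \<phi> (\<Sum>b\<in>Basis. scale (representation Basis u b) b)" by (simp add: rep_expand)
  also have "\<dots> = (\<Sum>b\<in>Basis. representation Basis u b * \<phi> b)"
    by (simp add: Modules.module_hom.sum[OF Vector_Spaces.linear.axioms(3)[OF assms]]
        Modules.module_hom.scale[OF Vector_Spaces.linear.axioms(3)[OF assms]])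
  finally show ?thesis by (simp add: trace_def rep_simps mult.commute)
qed

lemma functional_rep:
  assumes "endo f"
  shows "Vector_Spaces.linear scale (*) (\<lambda>v. representation Basis (f v) b)"
  using assms vector_space_axioms
  by (auto simp: Vector_Spaces.linear_iff rep_simps vector_space_def algebra_simps)

text \<open>The composite of \<open>f\<close> after \<open>g\<close> is the sum over
  \<open>Basis\<close> of the rank-one maps sending \<open>v\<close> to the
  \<open>b\<close>-coordinate of \<open>g v\<close> times \<open>f b\<close>. Their traces are the
  diagonal entries of \<open>g\<close> after \<open>f\<close>.\<close>

lemma trace_comp_commute:
  assumes f: "endo f" and g: "endo g"
  shows "trace (\<lambda>v. f (g v)) = trace (\<lambda>v. g (f v))"
proof -
  have "f (g v) = (\<Sum>b\<in>Basis. scale (representation Basis (g v) b) (f b))" for v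
    by (subst rep_expand[of "g v", symmetric]) (simp add: endo_sum endo_scale f)
  then have "trace (\<lambda>v. f (g v))
      = (\<Sum>b\<in>Basis. trace (\<lambda>v. scale (representation Basis (g v) b) (f b)))"
    by (simp add: trace_sum)
  also have "\<dots> = trace (\<lambda>v. g (f v))"
    by (simp add: trace_rank_one functional_rep g) (simp add: trace_def)
  finally show ?thesis .
qed

text \<open>A basis \<open>A\<close> of the range writes \<open>p\<close> as a sum of rank-one maps,
  each of trace 1 because \<open>p\<close> fixes \<open>A\<close>. So \<open>n\<close> is the rank.
  The second conclusion speaks of \<open>n\<close> and not of the trace, since \<open>of_nat\<close>
  need not be injective in a field.\<close>

lemma trace_idempotent:
  assumes p: "endo p" and idem: "\<And>v. p (p v) = p v"
  obtains n :: nat where "trace p = of_nat n" "n = 0 \<Longrightarrow> p = (\<lambda>v. 0)"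
proof -
  obtain A where A: "A \<subseteq> range p" "independent A" "range p \<subseteq> span A"
    by (rule basis_exists[of "range p"])
  have fin: "finite A" using finiteI_independent A by blast
  have inS: "p v \<in> span A" for v using A by blast
  have ex: "(\<Sum>a\<in>A. scale (representation A (p v) a) a) = p v" for v
    by (rule sum_representation_eq) (auto simp: A inS fin)
  have pA: "p a = a" if "a \<in> A" for a
    using A(1) that idem by auto
  have lin: "Vector_Spaces.linear scale (*) (\<lambda>v. representation A (p v) a)" for a
    using p vector_space_axioms
    by (auto simp: Vector_Spaces.linear_iff representation_add[OF A(2) inS inS]
        representation_scale[OF A(2) inS] vector_space_def algebra_simps)
  have "trace p = trace (\<lambda>v. \<Sum>a\<in>A. scale (representation A (p v) a) a)" by (simp add: ex)
  also have "\<dots> = (\<Sum>a\<in>A. representation A (p a) a)"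
    by (simp add: trace_sum trace_rank_one lin)
  also have "\<dots> = (\<Sum>a\<in>A. 1)"
    by (rule sum.cong) (simp_all add: pA representation_basis[OF A(2)])
  finally have "trace p = of_nat (card A)" by simp
  moreover have "p = (\<lambda>v. 0)" if "card A = 0"
    using ex that fin by (simp add: fun_eq_iff)
  ultimately show ?thesis by (rule that)
qed

text \<open>Choose \<open>g\<close> that inverts \<open>f\<close> from the right on its range, so
  that f g f = f. Then f has the same trace as f f g, whose n-th power is f^(n+1) g, and the
  nilpotency index has dropped by one.\<close>

lemma trace_nilpotent:
  assumes "endo f" "\<And>v. (f ^^ n) v = 0"
  shows "trace f = 0"
  using assms
proof (induction n arbitrary: f)
  case 0
  then have "f = (\<lambda>v. 0)" by (metis funpow_0)
  then show ?case by simp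
next
  case (Suc n)
  interpret vector_space_pair scale scale by unfold_locales
  obtain A where A: "A \<subseteq> range f" "independent A" "range f \<subseteq> span A"
    by (rule basis_exists[of "range f"])
  have "\<exists>g. endo g \<and> (\<forall>a\<in>A. g a = inv_into UNIV f a)"
    using linear_independent_extend[OF A(2)] by blast
  then obtain g where g: "endo g" "\<And>a. a \<in> A \<Longrightarrow> g a = inv_into UNIV f a" by blast
  have fg: "f (g w) = w" if "w \<in> span A" for w
  proof -
    have "A \<subseteq> {w. f (g w) = w}"
      using g A(1) by (auto simp: f_inv_into_f)
    moreover have "subspace {w. f (g w) = w}"
      by (rule subspaceI) (simp_all add: endo_zero endo_add endo_scale g Suc.prems)
    ultimately have "span A \<subseteq> {w. f (g w) = w}" by (rule span_minimal)
    then show ?thesis using that by blast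
  qed
  have fgf: "f (g (f v)) = f v" for v using fg A(3) by blast
  let ?h = "\<lambda>v. f (f (g v))"
  have pow: "(?h ^^ k) v = (f ^^ Suc k) (g v)" if "k > 0" for k v
    using that
  proof (induction k)
    case (Suc k)
    show ?case
    proof (cases "k = 0")
      case False
      then have "(?h ^^ Suc k) v = f (f (g ((f ^^ Suc k) (g v))))" using Suc by simp
      then show ?thesis using fgf by simp
    qed simp
  qed simp
  \<comment> \<open>The formula \<open>pow\<close> fails for exponent 0, so the case where
    \<open>f\<close> itself is zero is treated apart.\<close>
  show ?case
  proof (cases "n = 0")
    case True
    then have "f = (\<lambda>v. 0)" using Suc.prems(2) by auto
    then show ?thesis by simp
  next
    case False
    then have hn: "(?h ^^ n) v = 0" for v using pow Suc.prems(2) by (simp del: funpow.simps)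
  have "endo ?h" using endo_comp[OF Suc.prems(1) endo_comp[OF Suc.prems(1) g(1)]] .
  then have "trace ?h = 0" using Suc.IH hn by blast
  moreover have "trace (\<lambda>v. f (f (g v))) = trace (\<lambda>v. f (g (f v)))"
    using trace_comp_commute[OF Suc.prems(1) endo_comp[OF Suc.prems(1) g(1)]] .
    ultimately show ?thesis by (simp add: fgf)
  qed
qed

end

section \<open>Coprime complex polynomials and generalised eigencomponents\<close>

lemma complex_poly_bezout:
  fixes p q :: "complex poly"
  assumes "coprime p q"
  obtains a b where "a * p + b * q = 1"
  using bezout_coefficients_fst_snd[of p q] assms by auto

lemma coprime_linear_polys:
  fixes a b :: complex
  assumes "a \<noteq> b"
  shows "coprime ([:- a, 1:] ^ m) ([:- b, 1:] ^ n)"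
proof -
  have "coprime [:- a, 1:] [:- b, 1:]"
  proof (rule coprimeI)
    fix c assume "c dvd [:- a, 1:]" "c dvd [:- b, 1:]"
    then have "c dvd [:- a, 1:] - [:- b, 1:]" by (rule dvd_diff)
    then have "c dvd [:b - a:]" by simp
    moreover have "is_unit [:b - a:]" using assms by (simp add: is_unit_const_poly_iff dvd_field_iff)
    ultimately show "is_unit c" by (rule dvd_unit_imp_unit)
  qed
  then show ?thesis by simp
qed

lemma prod_coprime_dvd:
  fixes f :: "'i \<Rightarrow> complex poly"
  assumes "finite A" "\<And>i. i \<in> A \<Longrightarrow> f i dvd c"
    "\<And>i j. i \<in> A \<Longrightarrow> j \<in> A \<Longrightarrow> i \<noteq> j \<Longrightarrow> coprime (f i) (f j)"
  shows "prod f A dvd c"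
  using assms
proof (induction A)
  case (insert i A)
  have "coprime (f i) (prod f A)"
    by (rule prod_coprime_right) (use insert in \<open>auto\<close>)
  then show ?case using insert by (simp add: divides_mult)
qed simp

text \<open>Algebraic closedness enters here. Divisibility instead of equality absorbs the leading
  coefficient.\<close>

lemma complex_poly_split:
  fixes p :: "complex poly"
  assumes "p \<noteq> 0"
  shows "p dvd (\<Prod>z | poly p z = 0. [:- z, 1:] ^ order z p)"
proof -
  have "Polynomial.smult (lead_coeff p) (\<Prod>z | poly p z = 0. [:- z, 1:] ^ order z p)
      dvd (\<Prod>z | poly p z = 0. [:- z, 1:] ^ order z p)"
    using assms by (simp only: smult_dvd_iff) simp
  then show ?thesis by (simp only: complex_poly_decompose)
qed

locale complex_operators = operators scale
  for scale :: "complex \<Rightarrow> 'b::ab_group_add \<Rightarrow> 'b" (infixr \<open>*s\<close> 75)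
begin

text \<open>The product \<open>R\<close> kills every component but \<open>U c\<close>, and X R is
  invertible modulo (X - c)^n because \<open>c\<close> is nonzero. Hence \<open>U c\<close> is a
  polynomial in \<open>A\<close> applied to \<open>A (sum U F)\<close>. The factor X is the reason
  why only the image of the sum has to lie in \<open>S\<close>.\<close>

lemma eigencomponent_in_stable_subspace:
  assumes A: "endo A" and S: "subspace S" "\<And>v. v \<in> S \<Longrightarrow> A v \<in> S"
    and F: "finite F" and U: "\<And>a. a \<in> F \<Longrightarrow> ((\<lambda>v. A v - a *s v) ^^ n) (U a) = 0"
    and AT: "A (sum U F) \<in> S" and c: "c \<in> F" "c \<noteq> 0"
  shows "U c \<in> S"
proof -
  define R where "R = (\<Prod>a\<in>F - {c}. [:- a, 1:] ^ n)"
  have "coprime [:0, 1:] ([:- c, 1:] ^ n)"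
    using coprime_linear_polys[of 0 c 1 n] c by simp
  moreover have "coprime R ([:- c, 1:] ^ n)"
    unfolding R_def by (rule prod_coprime_left) (rule coprime_linear_polys, auto)
  ultimately have "coprime ([:0, 1:] * R) ([:- c, 1:] ^ n)"
    by (simp only: coprime_mult_left_iff)
  then obtain a b where ab: "a * ([:0, 1:] * R) + b * [:- c, 1:] ^ n = 1"
    by (rule complex_poly_bezout)
  have kill: "poly_op ([:- d, 1:] ^ n) A (U d) = 0" if "d \<in> F" for d
    using U[OF that] by (simp only: poly_op_linear_power[OF A])
  have RU: "poly_op R A (U d) = 0" if "d \<in> F - {c}" for d
  proof -
    have "R = (\<Prod>a\<in>F - {c} - {d}. [:- a, 1:] ^ n) * [:- d, 1:] ^ n"
      unfolding R_def using that F by (simp add: prod.remove mult.commute)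
    then show ?thesis
      using that by (simp add: poly_op_mult[OF A] kill endo_zero[OF endo_poly_op[OF A]] del: power.simps)
  qed
  have "poly_op R A (sum U F) = (\<Sum>d\<in>F. poly_op R A (U d))"
    by (rule endo_sum[OF endo_poly_op[OF A]])
  also have "\<dots> = poly_op R A (U c)"
    using c F RU by (simp add: sum.remove)
  finally have RT: "poly_op R A (sum U F) = poly_op R A (U c)" .
  have "U c = poly_op (a * ([:0, 1:] * R) + b * [:- c, 1:] ^ n) A (U c)"
    by (simp only: ab poly_op_1)
  also have "\<dots> = poly_op (a * ([:0, 1:] * R)) A (U c)"
    using kill[OF c(1)] by (simp only: poly_op_add poly_op_mult[OF A] endo_zero[OF endo_poly_op[OF A]]) simp
  also have "\<dots> = poly_op a A (A (poly_op R A (U c)))"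
    by (simp only: poly_op_mult[OF A]) (simp add: poly_op_pCons[OF A] endo_zero[OF A])
  also have "\<dots> = poly_op a A (poly_op R A (A (sum U F)))"
    by (simp add: RT[symmetric] poly_op_commute[OF A A])
  also have "\<dots> \<in> S"
    by (intro poly_op_subspace A S AT)
  finally show ?thesis .
qed

end

section \<open>Fitting and primary decomposition of an operator\<close>

locale complex_fd_operators = complex_operators scale + fd_operators scale Basis
  for scale :: "complex \<Rightarrow> 'b::ab_group_add \<Rightarrow> 'b" (infixr \<open>*s\<close> 75) and Basis
begin

lemma poly_op_dvd_zero:
  assumes "endo f" "\<And>v. poly_op p f v = 0" "p dvd q"
  shows "poly_op q f v = 0"
proof -
  obtain r where "q = r * p" using assms(3) by (metis dvd_def mult.commute)
  then show ?thesis
    by (simp only: poly_op_mult[OF assms(1)] assms(2) endo_zero[OF endo_poly_op[OF assms(1)]])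
qed

text \<open>Split an annihilator as X^k r with r prime to X. Bezout then yields an idempotent
  polynomial in \<open>f\<close> that projects onto the part where \<open>f\<close> is invertible,
  and \<open>poly_op g f\<close> is an inverse of \<open>f\<close> on that part.\<close>

lemma fitting:
  assumes f: "endo f"
  obtains g N where "\<And>v. f (poly_op g f (f (poly_op g f v))) = f (poly_op g f v)"
    "\<And>v. (f ^^ N) (v - f (poly_op g f v)) = 0"
proof -
  obtain p where p: "p \<noteq> 0" "\<And>v. poly_op p f v = 0"
    using annihilator_exists[OF f] by blast
  obtain r where r: "p = [:- 0, 1:] ^ order 0 p * r" "\<not> [:- 0, 1:] dvd r"
    using order_decomp[OF p(1)] by blast
  \<comment> \<open>One more than the order, so that X divides \<open>q\<close> even when 0 is not a
    root of \<open>p\<close>; this gives the idempotent the form f g(f).\<close>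
  define N where "N = Suc (order 0 p)"
  have "coprime [:- 0, 1:] r"
    using r(2) by (intro prime_elem_imp_coprime prime_elem_linear_field_poly) auto
  then have "coprime ([:0, 1:] ^ N) r" by simp
  then obtain a b where ab: "a * [:0, 1:] ^ N + b * r = 1"
    by (rule complex_poly_bezout)
  define q where "q = a * [:0, 1:] ^ N"
  have br: "b * r = 1 - q" using ab by (simp add: q_def algebra_simps)
  \<comment> \<open>Since \<open>b * r\<close> is \<open>1 - q\<close>, this one vanishing gives
    both the idempotence of \<open>q\<close> and the nilpotence of \<open>f\<close> on the range of
    \<open>1 - q\<close>.\<close>
  have ann: "poly_op ([:0, 1:] ^ N * (b * r)) f v = 0" for v
  proof (rule poly_op_dvd_zero[OF f p(2)])
    have "[:0, 1:] ^ N * (b * r) = ([:- 0, 1:] ^ order 0 p * r) * ([:0, 1:] * b)"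
      by (simp only: N_def power_Suc minus_zero mult_ac)
    then show "p dvd [:0, 1:] ^ N * (b * r)" by (simp only: r(1)[symmetric] dvd_triv_left)
  qed
  define g where "g = a * [:0, 1:] ^ order 0 p"
  have qg: "poly_op q f v = f (poly_op g f v)" for v
  proof -
    have "q = pCons 0 g" by (simp add: q_def g_def N_def)
    then show ?thesis by (simp add: poly_op_pCons[OF f])
  qed
  have idem: "poly_op q f (poly_op q f v) = poly_op q f v" for v
  proof -
    have "poly_op (q * (1 - q)) f v = 0"
      by (rule poly_op_dvd_zero[OF f ann]) (simp add: q_def[symmetric] br, simp add: q_def)
    then show ?thesis by (simp add: poly_op_mult[OF f] poly_op_diff endo_diff[OF endo_poly_op[OF f]])
  qed
  have "(f ^^ N) (v - poly_op q f v) = 0" for v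
    using ann[of v] poly_op_linear_power[OF f, of 0 N]
    by (simp add: poly_op_mult[OF f] br poly_op_diff)
  with idem show ?thesis by (intro that[of g N]) (simp_all add: qg)
qed

text \<open>Chinese remainder theorem: \<open>P z\<close> is 1 modulo \<open>M z\<close> and 0
  modulo the other factors, and the product of all factors annihilates \<open>x\<close>. The common
  exponent \<open>degree p\<close> bounds the multiplicity of every root. Roots of \<open>p\<close>
  that are not eigenvalues merely contribute zero projections.\<close>

lemma primary_decomposition:
  assumes x: "endo x"
  obtains F :: "complex set" and \<pi> and N where "finite F"
    "\<And>a. a \<in> F \<Longrightarrow> endo (\<pi> a)"
    "\<And>v. (\<Sum>a\<in>F. \<pi> a v) = v"
    "\<And>a v. a \<in> F \<Longrightarrow> \<pi> a (\<pi> a v) = \<pi> a v"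
    "\<And>a v. a \<in> F \<Longrightarrow> \<pi> a (x v) = x (\<pi> a v)"
    "\<And>a v. a \<in> F \<Longrightarrow> ((\<lambda>v. x v - a *s v) ^^ N) (\<pi> a v) = 0"
proof -
  obtain p where p: "p \<noteq> 0" "\<And>v. poly_op p x v = 0"
    using annihilator_exists[OF x] by blast
  define F where "F = {z. poly p z = 0}"
  have fin: "finite F" using p(1) poly_roots_finite by (auto simp: F_def)
  define N where "N = degree p"
  define M where "M = (\<lambda>z::complex. [:- z, 1:] ^ N)"
  define m where "m = prod M F"
  have ord: "order z p \<le> N" for z using order_degree[OF p(1)] by (simp add: N_def)
  have "p dvd m"
    unfolding m_def M_def F_def
    by (rule dvd_trans[OF complex_poly_split[OF p(1)] prod_dvd_prod]) (simp add: le_imp_power_dvd ord)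
  then have ann: "m dvd q \<Longrightarrow> poly_op q x v = 0" for q v
    using poly_op_dvd_zero[OF x p(2)] dvd_trans by blast
  define R where "R = (\<lambda>z. prod M (F - {z}))"
  have cop: "a \<noteq> b \<Longrightarrow> coprime (M a) (M b)" for a b
    unfolding M_def by (rule coprime_linear_polys)
  have MR: "m = M z * R z" if "z \<in> F" for z
    using that fin by (simp add: m_def R_def prod.remove)
  have MdR: "M a dvd R b" if "a \<in> F" "a \<noteq> b" for a b
    unfolding R_def using that fin by (intro dvd_prodI) auto
  have "\<exists>a b. a * R z + b * M z = 1" for z
  proof -
    have "coprime (R z) (M z)" unfolding R_def by (rule prod_coprime_left) (auto intro: cop)
    then show ?thesis by (rule complex_poly_bezout) blast
  qed
  then obtain a b where ab: "\<And>z. a z * R z + b z * M z = 1" by metis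
  define P where "P = (\<lambda>z. a z * R z)"
  have sum1: "poly_op (sum P F) x v = v" for v
  proof -
    have "M z dvd sum P F - 1" if z: "z \<in> F" for z
    proof -
      have "sum P F - 1 = (P z - 1) + sum P (F - {z})"
        using z fin by (simp add: sum.remove)
      moreover have "P z - 1 = M z * (- b z)" using ab[of z] by (simp add: P_def algebra_simps)
      moreover have "M z dvd sum P (F - {z})"
        by (rule dvd_sum) (use MdR z in \<open>auto simp: P_def\<close>)
      ultimately show ?thesis by (metis dvd_add dvd_triv_left)
    qed
    then have "m dvd sum P F - 1"
      unfolding m_def by (intro prod_coprime_dvd fin cop)
    then show ?thesis using ann[of "sum P F - 1" v] by (simp add: poly_op_diff)
  qed
  have opsum: "poly_op (sum P A) x v = (\<Sum>z\<in>A. poly_op (P z) x v)" for A v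
    by (induction A rule: infinite_finite_induct) (simp_all add: poly_op_add)
  have orth: "poly_op (P z) x (poly_op (P w) x v) = 0" if "z \<in> F" "w \<in> F" "z \<noteq> w" for z w v
  proof -
    have "m dvd P z * P w"
      unfolding MR[OF that(1)] P_def using MdR[OF that(1,3)]
      by (simp add: mult.commute mult_dvd_mono dvd_mult2 mult.left_commute)
    then show ?thesis using ann[of "P z * P w" v] by (simp add: poly_op_mult[OF x])
  qed
  show ?thesis
  proof (rule that[of F "\<lambda>z. poly_op (P z) x" N])
    show "finite F" by (rule fin)
    show "endo (poly_op (P z) x)" for z by (rule endo_poly_op[OF x])
    show "(\<Sum>z\<in>F. poly_op (P z) x v) = v" for v using sum1 opsum by simp
    show "poly_op (P z) x (x v) = x (poly_op (P z) x v)" for z v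
      by (rule poly_op_commute[OF x x, symmetric]) simp
    show "poly_op (P z) x (poly_op (P z) x v) = poly_op (P z) x v" if "z \<in> F" for z v
    proof -
      have "poly_op (P z) x v = poly_op (P z) x (\<Sum>w\<in>F. poly_op (P w) x v)"
        using sum1[of v] opsum[of F v] by simp
      also have "\<dots> = (\<Sum>w\<in>F. poly_op (P z) x (poly_op (P w) x v))"
        by (rule endo_sum[OF endo_poly_op[OF x]])
      also have "\<dots> = (\<Sum>w\<in>F. if w = z then poly_op (P z) x (poly_op (P z) x v) else 0)"
        by (rule sum.cong) (auto simp: orth that)
      also have "\<dots> = poly_op (P z) x (poly_op (P z) x v)" using that fin by (simp add: sum.delta)
      finally show ?thesis by simp
    qed
    show "((\<lambda>v. x v - z *s v) ^^ N) (poly_op (P z) x v) = 0" if "z \<in> F" for z v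
    proof -
      have "m dvd M z * P z" unfolding MR[OF that] P_def by (simp add: mult_dvd_mono)
      from ann[OF this, of v] show ?thesis
        by (simp only: poly_op_mult[OF x] M_def poly_op_linear_power[OF x])
    qed
  qed
qed

end

section \<open>Commutator maps and conjugate eigenvalues\<close>

definition commutator :: "('b::ab_group_add \<Rightarrow> 'b) \<Rightarrow> ('b \<Rightarrow> 'b) \<Rightarrow> 'b \<Rightarrow> 'b" where
  "commutator x T = (\<lambda>v. x (T v) - T (x v))"

lemma (in vector_space) vector_space_fun: "vector_space (fun_scale scale :: _ \<Rightarrow> ('c \<Rightarrow> 'b) \<Rightarrow> _)"
  by unfold_locales
    (auto simp: fun_scale_def fun_eq_iff scale_right_distrib scale_left_distrib)

context operators
begin

interpretation F: operators "fun_scale scale :: 'a \<Rightarrow> ('b \<Rightarrow> 'b) \<Rightarrow> _"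
  by (rule operators.intro[OF vector_space_fun])

text \<open>The ambient space consists of all maps, linear or not. Linearity of \<open>x\<close>
  suffices here, and the calculus of polynomials in an operator becomes available for
  \<open>commutator x\<close> itself.\<close>

lemma endo_commutator: "endo x \<Longrightarrow> F.endo (commutator x)"
  by (rule F.endoI)
    (simp_all add: commutator_def fun_eq_iff fun_scale_def endo_add[of x] endo_scale[of x]
      scale_right_diff_distrib)

text \<open>The shifted commutator is left multiplication by x - a minus right multiplication by x -
  b. One application leaves a difference of two maps, of which the first needs one factor less on
  the left and the second one factor less on the right; induction on \<open>m + n\<close> thus
  replaces the binomial formula.\<close>

lemma commutator_nilpotent:
  assumes x: "endo x" and T: "endo T"
    and l: "\<And>v. ((\<lambda>v. x v - scale a v) ^^ m) (T v) = 0"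
    and r: "\<And>v. T (((\<lambda>v. x v - scale b v) ^^ n) v) = 0"
  shows "((\<lambda>T. commutator x T - fun_scale scale (a - b) T) ^^ (m + n)) T = 0"
  using T l r
proof (induction "m + n" arbitrary: m n T)
  case 0
  then show ?case by (simp add: fun_eq_iff)
next
  case (Suc k)
  let ?D = "\<lambda>T. commutator x T - fun_scale scale (a - b) T"
  let ?l = "\<lambda>v. x v - scale a v" and ?r = "\<lambda>v. x v - scale b v"
  have D: "F.endo ?D"
    by (intro F.endo_minus F.endo_cmult F.endo_id endo_commutator x)
  have le: "endo ?l" and re: "endo ?r"
    by (intro endo_minus endo_cmult endo_id x)+
  have z: "(?D ^^ k) 0 = 0" for k by (rule F.endo_zero[OF F.endo_funpow[OF D]])
  show ?case
  proof (cases "m = 0 \<or> n = 0")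
    case True
    then have "T v = 0" for v
      using Suc.prems(2)[of v] Suc.prems(3)[of v] by (elim disjE) simp_all
    then have "T = 0" by (simp add: fun_eq_iff)
    then show ?thesis by (simp only: z)
  next
    case False
    then obtain m' n' where mn: "m = Suc m'" "n = Suc n'" by (metis not0_implies_Suc)
    have "(?D ^^ (m' + n)) (\<lambda>v. ?l (T v)) = 0"
    proof (rule Suc.hyps(1))
      show "k = m' + n" using Suc.hyps(2) mn by simp
      show "endo (\<lambda>v. ?l (T v))" by (rule endo_comp[OF le Suc.prems(1)])
      show "(?l ^^ m') (?l (T v)) = 0" for v
        using Suc.prems(2)[of v] by (simp add: mn funpow_Suc_right del: funpow.simps)
      show "?l (T ((?r ^^ n) v)) = 0" for v
        using Suc.prems(3)[of v] endo_zero[OF le] by simp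
    qed
    moreover have "(?D ^^ (m + n')) (\<lambda>v. T (?r v)) = 0"
    proof (rule Suc.hyps(1))
      show "k = m + n'" using Suc.hyps(2) mn by simp
      show "endo (\<lambda>v. T (?r v))" by (rule endo_comp[OF Suc.prems(1) re])
      show "(?l ^^ m) (T (?r v)) = 0" for v by (rule Suc.prems(2))
      show "T (?r ((?r ^^ n') v)) = 0" for v
        using Suc.prems(3)[of v] by (simp add: mn)
    qed
    moreover have "m' + n = k" "m + n' = k" using Suc.hyps(2) mn by simp_all
    ultimately have "(?D ^^ k) ((\<lambda>v. ?l (T v)) - (\<lambda>v. T (?r v))) = 0"
      by (simp add: F.endo_diff[OF F.endo_funpow[OF D]])
    moreover have "?D T = (\<lambda>v. ?l (T v)) - (\<lambda>v. T (?r v))"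
      by (simp add: commutator_def fun_scale_def fun_eq_iff endo_diff[OF Suc.prems(1)]
          endo_scale[OF Suc.prems(1)] scale_left_diff_distrib)
    ultimately have "(?D ^^ Suc k) T = 0" by (simp add: funpow_Suc_right del: funpow.simps)
    then show ?thesis by (simp only: Suc.hyps(2))
  qed
qed

end

lemma sum_fun_apply: "(\<Sum>i\<in>A. f i) v = (\<Sum>i\<in>A. f i v :: 'c::ab_group_add)"
  by (induction A rule: infinite_finite_induct) simp_all

context complex_fd_operators
begin

interpretation F: complex_operators "fun_scale scale :: complex \<Rightarrow> ('b \<Rightarrow> 'b) \<Rightarrow> _"
  by (intro complex_operators.intro operators.intro vector_space_fun)

text \<open>On a sum of generalised eigenspaces of \<open>x\<close>, let \<open>y\<close> act by the conjugate eigenvalues.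
  Then \<open>ad y\<close> is a polynomial without constant term in \<open>ad x\<close>, and \<open>trace (x y)\<close> is the sum of
  the squared moduli of the eigenvalues of \<open>x\<close>.\<close>

theorem conjugate_semisimple_part:
  assumes x: "endo x"
  obtains y where "endo y"
    "\<And>S T. F.subspace S \<Longrightarrow> (\<And>U. U \<in> S \<Longrightarrow> commutator x U \<in> S) \<Longrightarrow> endo T \<Longrightarrow>
      commutator x T \<in> S \<Longrightarrow> commutator y T \<in> S"
    "trace (\<lambda>v. x (y v)) = 0 \<Longrightarrow> \<exists>n. \<forall>v. (x ^^ n) v = 0"
proof -
  obtain F \<pi> N where F: "finite F"
    and \<pi>: "\<And>a. a \<in> F \<Longrightarrow> endo (\<pi> a)"
    and one: "\<And>v. (\<Sum>a\<in>F. \<pi> a v) = v"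
    and idem: "\<And>a v. a \<in> F \<Longrightarrow> \<pi> a (\<pi> a v) = \<pi> a v"
    and comm: "\<And>a v. a \<in> F \<Longrightarrow> \<pi> a (x v) = x (\<pi> a v)"
    and nil: "\<And>a v. a \<in> F \<Longrightarrow> ((\<lambda>v. x v - a *s v) ^^ N) (\<pi> a v) = 0"
    by (rule primary_decomposition[OF x]) blast
  define y where "y = (\<lambda>v. \<Sum>a\<in>F. cnj a *s \<pi> a v)"
  have y: "endo y" unfolding y_def by (intro endo_sum_map endo_cmult \<pi>)
  have shift: "endo (\<lambda>v. x v - a *s v)" for a by (intro endo_minus endo_cmult endo_id x)
  have comm_pow: "\<pi> a (((\<lambda>v. x v - a *s v) ^^ k) v) = ((\<lambda>v. x v - a *s v) ^^ k) (\<pi> a v)"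
    if "a \<in> F" for a k v
    by (induction k) (simp_all add: endo_diff[OF \<pi>[OF that]] endo_scale[OF \<pi>[OF that]] comm[OF that])
  show ?thesis
  proof (rule that[OF y])
    fix S T
    assume S: "F.subspace S" "\<And>U. U \<in> S \<Longrightarrow> commutator x U \<in> S"
      and T: "endo T" and xT: "commutator x T \<in> S"
    \<comment> \<open>\<open>W (a, b)\<close> is the block of \<open>T\<close> from the part of
      eigenvalue b to that of eigenvalue a. On it \<open>commutator x\<close> has the single
      generalised eigenvalue a - b, so \<open>U c\<close> collects the component of \<open>T\<close>
      for eigenvalue c.\<close>
    define W where "W = (\<lambda>p v. \<pi> (fst p) (T (\<pi> (snd p) v)))"
    define G where "G = (\<lambda>p. fst p - snd p) ` (F \<times> F)"
    define U where "U = (\<lambda>c. \<Sum>p | p \<in> F \<times> F \<and> fst p - snd p = c. W p)"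
    have regroup: "(\<Sum>p\<in>F \<times> F. h p) = (\<Sum>c\<in>G. \<Sum>p | p \<in> F \<times> F \<and> fst p - snd p = c. h p)"
      for h :: "_ \<Rightarrow> 'b \<Rightarrow> 'b"
      unfolding G_def by (rule sum.image_gen) (simp add: F)
    have W_sum: "(\<Sum>p\<in>F \<times> F. W p v) = T v" for v
    proof -
      have "(\<Sum>p\<in>F \<times> F. W p v) = (\<Sum>a\<in>F. \<Sum>b\<in>F. \<pi> a (T (\<pi> b v)))"
        by (simp add: W_def sum.cartesian_product case_prod_beta)
      also have "\<dots> = (\<Sum>a\<in>F. \<pi> a (T (\<Sum>b\<in>F. \<pi> b v)))"
        by (rule sum.cong) (simp_all only: endo_sum[OF T] endo_sum[OF \<pi>])
      finally show ?thesis by (simp only: one)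
    qed
    have WT: "sum U G = T"
      unfolding U_def regroup[symmetric] using W_sum by (simp add: fun_eq_iff sum_fun_apply)
    have Wnil: "((\<lambda>T. commutator x T - fun_scale scale (fst p - snd p) T) ^^ (N + N)) (W p) = 0"
      if p: "p \<in> F \<times> F" for p
    proof (rule commutator_nilpotent[OF x])
      have pF: "fst p \<in> F" "snd p \<in> F" using p by auto
      show "endo (W p)" unfolding W_def by (intro endo_comp[OF \<pi> endo_comp[OF T \<pi>]] pF)
      show "((\<lambda>v. x v - fst p *s v) ^^ N) (W p v) = 0" for v
        unfolding W_def by (rule nil[OF pF(1)])
      show "W p (((\<lambda>v. x v - snd p *s v) ^^ N) v) = 0" for v
        by (simp add: W_def comm_pow[OF pF(2)] nil[OF pF(2)] endo_zero[OF T] endo_zero[OF \<pi>[OF pF(1)]])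
    qed
    have D: "F.endo (\<lambda>T. commutator x T - fun_scale scale c T)" for c
      by (intro F.endo_minus F.endo_cmult F.endo_id endo_commutator x)
    have Unil: "((\<lambda>T. commutator x T - fun_scale scale c T) ^^ (N + N)) (U c) = 0" for c
      unfolding U_def F.endo_sum[OF F.endo_funpow[OF D]]
      by (rule sum.neutral) (use Wnil in auto)
    \<comment> \<open>Nothing is known about \<open>U 0\<close>, but its coefficient
      \<open>cnj 0\<close> erases it.\<close>
    have inS: "fun_scale scale (cnj c) (U c) \<in> S" if "c \<in> G" for c
    proof (cases "c = 0")
      case True
      then show ?thesis using F.subspace_0[OF S(1)] by simp
    next
      case False
      have "U c \<in> S"
      proof (rule F.eigencomponent_in_stable_subspace[OF endo_commutator[OF x] S, where F = G])
        show "finite G" using F by (simp add: G_def)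
        show "commutator x (sum U G) \<in> S" unfolding WT by (rule xT)
        show "((\<lambda>T. commutator x T - fun_scale scale a T) ^^ (N + N)) (U a) = 0" for a
          by (rule Unil)
      qed (use that False in auto)
      then show ?thesis by (rule F.subspace_scale[OF S(1)])
    qed
    have "commutator y T = (\<Sum>p\<in>F \<times> F. fun_scale scale (cnj (fst p - snd p)) (W p))"
    proof
      fix v
      have "T (\<pi> b v) = (\<Sum>a\<in>F. \<pi> a (T (\<pi> b v)))" for b by (simp only: one)
      then have "T (y v) = (\<Sum>b\<in>F. cnj b *s (\<Sum>a\<in>F. \<pi> a (T (\<pi> b v))))"
        by (simp only: y_def endo_sum[OF T] endo_scale[OF T])
      also have "\<dots> = (\<Sum>a\<in>F. \<Sum>b\<in>F. cnj b *s \<pi> a (T (\<pi> b v)))"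
        by (simp only: scale_sum_right) (rule sum.swap)
      finally have Ty: "T (y v) = (\<Sum>p\<in>F \<times> F. cnj (snd p) *s W p v)"
        by (simp add: W_def sum.cartesian_product case_prod_beta)
      have "\<pi> a (T v) = (\<Sum>b\<in>F. \<pi> a (T (\<pi> b v)))" if "a \<in> F" for a
        by (simp only: endo_sum[OF T, symmetric] endo_sum[OF \<pi>[OF that], symmetric] one)
      then have "y (T v) = (\<Sum>a\<in>F. cnj a *s (\<Sum>b\<in>F. \<pi> a (T (\<pi> b v))))"
        by (simp add: y_def)
      then have yT: "y (T v) = (\<Sum>p\<in>F \<times> F. cnj (fst p) *s W p v)"
        by (simp add: W_def scale_sum_right sum.cartesian_product case_prod_beta)
      show "commutator y T v = (\<Sum>p\<in>F \<times> F. fun_scale scale (cnj (fst p - snd p)) (W p)) v"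
        by (simp add: commutator_def Ty yT sum_fun_apply fun_scale_def sum_subtractf
            scale_left_diff_distrib)
    qed
    also have "\<dots> = (\<Sum>c\<in>G. fun_scale scale (cnj c) (U c))"
      unfolding regroup U_def F.scale_sum_right by (intro sum.cong refl) auto
    also have "\<dots> \<in> S" by (rule F.subspace_sum[OF S(1) inS])
    finally show "commutator y T \<in> S" .
  next
    assume tr0: "trace (\<lambda>v. x (y v)) = 0"
    have "\<exists>n::nat. trace (\<pi> a) = of_nat n \<and> (n = 0 \<longrightarrow> \<pi> a = (\<lambda>v. 0))" if "a \<in> F" for a
      by (rule trace_idempotent[OF \<pi>[OF that] idem[OF that]]) blast
    then obtain r :: "complex \<Rightarrow> nat" where
      r: "\<And>a. a \<in> F \<Longrightarrow> trace (\<pi> a) = of_nat (r a)" "\<And>a. a \<in> F \<Longrightarrow> r a = 0 \<Longrightarrow> \<pi> a = (\<lambda>v. 0)"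
      by metis
    have tr: "trace (\<lambda>v. x (\<pi> a v)) = a * of_nat (r a)" if a: "a \<in> F" for a
    proof -
      let ?h = "\<lambda>v. x (\<pi> a v) - a *s \<pi> a v"
      have h: "endo ?h" by (rule endo_comp[OF shift \<pi>[OF a]])
      have "(?h ^^ k) (\<pi> a v) = ((\<lambda>v. x v - a *s v) ^^ k) (\<pi> a v)" for k v
      proof (induction k)
        case (Suc k)
        then show ?case using comm_pow[OF a, of k "\<pi> a v"] by (simp add: idem[OF a])
      qed simp
      moreover have "?h v = \<pi> a (x v - a *s v)" for v
        by (simp only: endo_diff[OF \<pi>[OF a]] endo_scale[OF \<pi>[OF a]] comm[OF a])
      \<comment> \<open>The first application of \<open>?h\<close> moves \<open>v\<close> into the
        range of \<open>\<pi> a\<close>, where \<open>N\<close> further ones give zero.\<close>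
      ultimately have "(?h ^^ Suc N) v = 0" for v
        by (simp only: funpow_Suc_right o_apply nil[OF a])
      then have "trace ?h = 0" by (rule trace_nilpotent[OF h])
      then show ?thesis by (simp add: trace_diff trace_cmult r(1)[OF a])
    qed
    have "x (y v) = (\<Sum>a\<in>F. cnj a *s x (\<pi> a v))" for v
      by (simp add: y_def endo_sum[OF x] endo_scale[OF x])
    then have "trace (\<lambda>v. x (y v)) = (\<Sum>a\<in>F. cnj a * (a * of_nat (r a)))"
      by (simp add: trace_sum trace_cmult tr)
    also have "\<dots> = of_real (\<Sum>a\<in>F. (cmod a)\<^sup>2 * r a)"
      by (simp only: of_real_sum of_real_mult complex_norm_square of_real_of_nat_eq mult_ac)
    finally have "complex_of_real (\<Sum>a\<in>F. (cmod a)\<^sup>2 * r a) = 0" using tr0 by metis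
    then have "(\<Sum>a\<in>F. (cmod a)\<^sup>2 * r a) = 0" by (simp only: of_real_eq_0_iff)
    then have "(cmod a)\<^sup>2 * r a = 0" if "a \<in> F" for a
      using that F by (subst (asm) sum_nonneg_eq_0_iff) auto
    then have "r a = 0" if "a \<in> F" "a \<noteq> 0" for a using that by auto
    then have zero: "\<pi> a v = 0" if "a \<in> F" "a \<noteq> 0" for a v
      using r(2)[OF that(1)] that by simp
    have "(x ^^ N) v = 0" for v
    proof -
      have "(x ^^ N) (\<pi> a v) = 0" if "a \<in> F" for a
      proof (cases "a = 0")
        case True
        then show ?thesis using nil[OF that, of v] by simp
      next
        case False
        then show ?thesis by (simp only: zero[OF that False] endo_zero[OF endo_funpow[OF x]])
      qed
      then have "(x ^^ N) (\<Sum>a\<in>F. \<pi> a v) = 0" by (simp add: endo_sum[OF endo_funpow[OF x]])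
      then show ?thesis by (simp only: one)
    qed
    then show "\<exists>n. \<forall>v. (x ^^ n) v = 0" by blast
  qed
qed

end

section \<open>Engel's theorem and Cartan's criterion\<close>

context lie_algebra
begin

lemma bracket_zero [simp]: "bracket 0 x = 0" "bracket x 0 = 0"
  using bracket_scale(1)[of 0 0 x] bracket_scale(2)[of x 0 0] by simp_all

lemma lie_idealD:
  assumes "lie_ideal scl bracket I"
  shows "subspace I" "y \<in> I \<Longrightarrow> bracket x y \<in> I" "y \<in> I \<Longrightarrow> bracket y x \<in> I"
proof -
  show *: "subspace I" "y \<in> I \<Longrightarrow> bracket x y \<in> I" for x y
    using assms by (auto simp: lie_ideal_def)
  show "bracket y x \<in> I" if "y \<in> I"
    using subspace_neg[OF *(1) *(2)[OF that, of x]] bracket_anti[of y x] by simp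
qed

lemma derived_subset_ideal:
  assumes "lie_ideal scl bracket I"
  shows "span {bracket x y | x y. x \<in> I \<and> y \<in> I} \<subseteq> I"
  by (rule span_minimal) (use lie_idealD[OF assms] in auto)

end

context lie_module
begin

lemma act_add: "act (x + y) m = act x m + act y m" "act x (m + n) = act x m + act x n"
  and act_scale: "act (scaleL k x) m = scaleM k (act x m)" "act x (scaleM k m) = scaleM k (act x m)"
  using act_linear_left[of m] act_linear_right[of x] by (simp_all add: Vector_Spaces.linear_iff)

lemma act_diff: "act (x - y) m = act x m - act y m" "act x (m - n) = act x m - act x n"
  using act_add(1)[of "x - y" y m] act_add(2)[of x "m - n" n] by (simp_all add: algebra_simps)

lemma act_zero [simp]: "act 0 m = 0" "act x 0 = 0"
  using act_diff(1)[of 0 0 m] act_diff(2)[of x 0 0] by simp_all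

lemma act_sum: "act (\<Sum>i\<in>A. f i) m = (\<Sum>i\<in>A. act (f i) m)" "act x (\<Sum>i\<in>A. g i) = (\<Sum>i\<in>A. act x (g i))"
  by (induction A rule: infinite_finite_induct) (simp_all add: act_add)

text \<open>\<open>flag K n\<close> holds the vectors killed by all products of \<open>n\<close>
  elements of \<open>K\<close>. That it is everything for some \<open>n\<close> means that
  \<open>K\<close> acts by simultaneously strictly triangular operators.\<close>

primrec flag :: "'l set \<Rightarrow> nat \<Rightarrow> 'm set" where
  "flag K 0 = {0}"
| "flag K (Suc n) = {v. \<forall>k\<in>K. act k v \<in> flag K n}"

lemma subspace_flag: "M.subspace (flag K n)"
  by (induction n)
    (auto simp: M.subspace_def act_add act_scale)

lemma flag_Suc_mono: "flag K n \<subseteq> flag K (Suc n)"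
  by (induction n) auto

lemma flag_mono: "m \<le> n \<Longrightarrow> flag K m \<subseteq> flag K n"
  using lift_Suc_mono_le[of "flag K"] flag_Suc_mono by blast

lemma act_flag:
  assumes "k \<in> K" "v \<in> flag K n"
  shows "act k v \<in> flag K (n - 1)"
  using assms by (cases n) auto

end

locale fd_lie_module = lie_module scaleL bracket scaleM act
  + LO: complex_fd_operators scaleL BL + MO: complex_fd_operators scaleM BM
  for scaleL :: "complex \<Rightarrow> 'l::ab_group_add \<Rightarrow> 'l"
    and bracket :: "'l \<Rightarrow> 'l \<Rightarrow> 'l"
    and scaleM :: "complex \<Rightarrow> 'm::ab_group_add \<Rightarrow> 'm"
    and act :: "'l \<Rightarrow> 'm \<Rightarrow> 'm"
    and BL BM
begin

text \<open>If no such \<open>h\<close> exists, bracketing with suitable elements of \<open>K\<close> never leads into \<open>K\<close>; but each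
  bracket moves the flag of \<open>K\<close> down by one more step, so after \<open>2 n\<close> brackets the operator is zero.\<close>

lemma engel_normalizer:
  assumes D: "L.subspace D" "\<And>x y. x \<in> D \<Longrightarrow> y \<in> D \<Longrightarrow> bracket x y \<in> D"
    and K: "K \<subset> D" "\<And>x. x \<in> D \<Longrightarrow> (\<And>v. act x v = 0) \<Longrightarrow> x \<in> K" "flag K n = UNIV"
  obtains h where "h \<in> D" "h \<notin> K" "\<And>k. k \<in> K \<Longrightarrow> bracket k h \<in> K"
proof (rule ccontr)
  note found = that
  assume "\<not> thesis"
  then have no: "\<exists>k\<in>K. bracket k h \<notin> K" if "h \<in> D" "h \<notin> K" for h
    using that found by blast
  \<comment> \<open>For \<open>m = 0\<close> the claim is free because the flag is full from index
    \<open>n\<close> on. For m = 2n and j = n it says that \<open>h\<close> acts as zero, which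
    would put \<open>h\<close> into \<open>K\<close>.\<close>
  have "\<exists>h. h \<in> D \<and> h \<notin> K \<and> (\<forall>j. \<forall>v\<in>flag K j. act h v \<in> flag K (j + n - m))" for m
  proof (induction m)
    case 0
    obtain h where "h \<in> D" "h \<notin> K" using K(1) by blast
    moreover have "flag K (j + n) = UNIV" for j using flag_mono[of n "j + n" K] K(3) by auto
    ultimately show ?case by auto
  next
    case (Suc m)
    then obtain h where h: "h \<in> D" "h \<notin> K" "\<And>j v. v \<in> flag K j \<Longrightarrow> act h v \<in> flag K (j + n - m)"
      by blast
    then obtain k where k: "k \<in> K" "bracket k h \<notin> K" using no by blast
    have "act (bracket k h) v \<in> flag K (j + n - Suc m)" if v: "v \<in> flag K j" for j v
    proof -
      have "act k (act h v) \<in> flag K (j + n - Suc m)"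
        using act_flag[OF k(1) h(3)[OF v]] by simp
      \<comment> \<open>Truncated subtraction gains no step at \<open>j = 0\<close>, but there
        \<open>v\<close> is zero.\<close>
      moreover have "act h (act k v) \<in> flag K (j + n - Suc m)"
      proof (cases j)
        case 0
        then have "v = 0" using v by simp
        then show ?thesis using M.subspace_0[OF subspace_flag] by simp
      next
        case (Suc i)
        then show ?thesis using h(3)[OF act_flag[OF k(1) v]] by simp
      qed
      ultimately show ?thesis
        unfolding act_bracket by (rule M.subspace_diff[OF subspace_flag])
    qed
    moreover have "bracket k h \<in> D" using D(2) k(1) K(1) h(1) by blast
    ultimately show ?case using k(2) by blast
  qed
  from this[of "n + n"] obtain h where h: "h \<in> D" "h \<notin> K"
    "\<And>v. v \<in> flag K n \<Longrightarrow> act h v \<in> flag K (n + n - (n + n))"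
    by blast
  then have "act h v = 0" for v using K(3) by simp
  then show False using K(2) h(1,2) by blast
qed

text \<open>As \<open>h\<close> normalises \<open>K\<close>, it preserves each
  \<open>flag K i\<close>. An element of \<open>K\<close> takes a vector to the next lower layer at
  once, while \<open>h\<close> can be applied at most \<open>m\<close> times inside a layer, so each
  layer refines into \<open>m\<close> layers of the larger set.\<close>

lemma engel_extend:
  assumes K: "\<And>k. k \<in> K \<Longrightarrow> bracket k h \<in> K" and h: "\<And>v. (act h ^^ m) v = 0"
  shows "flag K j \<subseteq> flag {k + scaleL c h | k c. k \<in> K} (m * j)"
proof (induction j)
  case (Suc j)
  let ?K' = "{k + scaleL c h | k c. k \<in> K}"
  have hflag: "act h v \<in> flag K i" if "v \<in> flag K i" for i v
    using that
  proof (induction i arbitrary: v)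
    case (Suc i)
    have "act k (act h v) \<in> flag K i" if k: "k \<in> K" for k
    proof -
      have "act k (act h v) = act (bracket k h) v + act h (act k v)" by (simp add: act_bracket)
      moreover have "act (bracket k h) v \<in> flag K i" "act k v \<in> flag K i" using Suc.prems k K by auto
      ultimately show ?thesis using Suc.IH M.subspace_add[OF subspace_flag] by metis
    qed
    then show ?case by simp
  qed simp
  have "v \<in> flag ?K' (m * j + i)" if "v \<in> flag K (Suc j)" "(act h ^^ i) v \<in> flag ?K' (m * j)" for i v
    using that
  proof (induction i arbitrary: v)
    case (Suc i)
    have "act k v \<in> flag ?K' (m * j + i)" if k: "k \<in> K" for k
    proof -
      have "act k v \<in> flag K j" using Suc.prems(1) k by simp
      then show ?thesis using \<open>flag K j \<subseteq> flag ?K' (m * j)\<close> flag_mono[of "m * j" "m * j + i" ?K'] by auto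
    qed
    moreover have "act h v \<in> flag ?K' (m * j + i)"
      using Suc.IH[OF hflag[OF Suc.prems(1)]] Suc.prems(2) by (simp add: funpow_Suc_right del: funpow.simps)
    ultimately show ?case
      using M.subspace_add[OF subspace_flag] M.subspace_scale[OF subspace_flag]
      by (auto simp: act_add act_scale simp del: flag.simps(1))
  qed simp
  from this[of _ m] show ?case
    using h M.subspace_0[OF subspace_flag] by (auto simp: add.commute)
qed simp

text \<open>A subalgebra \<open>K\<close> of maximal dimension among those with a full flag must be
  \<open>D\<close>, since otherwise a normalising element enlarges both it and its flag.\<close>

theorem engel:
  assumes D: "L.subspace D" "\<And>x y. x \<in> D \<Longrightarrow> y \<in> D \<Longrightarrow> bracket x y \<in> D"
    and nil: "\<And>x. x \<in> D \<Longrightarrow> \<exists>n. \<forall>v. (act x ^^ n) v = 0"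
  shows "\<exists>n. flag D n = UNIV"
proof -
  \<comment> \<open>The clause on elements acting as zero makes up for an action that need not be
    faithful: \<open>engel_normalizer\<close> ends with an element of \<open>D\<close> that acts as
    zero and has to find it in \<open>K\<close>.\<close>
  define good where "good K \<longleftrightarrow> L.subspace K \<and> K \<subseteq> D \<and> (\<forall>x\<in>D. (\<forall>v. act x v = 0) \<longrightarrow> x \<in> K) \<and>
    (\<forall>x\<in>K. \<forall>y\<in>K. bracket x y \<in> K) \<and> (\<exists>n. flag K n = UNIV)" for K
  have "good {x \<in> D. \<forall>v. act x v = 0}"
    unfolding good_def
  proof (intro conjI)
    show "L.subspace {x \<in> D. \<forall>v. act x v = 0}"
      using D(1) by (auto simp: L.subspace_def act_add act_scale)
    show "\<exists>n. flag {x \<in> D. \<forall>v. act x v = 0} n = UNIV"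
      by (rule exI[of _ "Suc 0"]) auto
  qed (auto simp: D(2) act_bracket)
  moreover have "\<forall>K. good K \<longrightarrow> L.dim K < Suc LO.dimension"
    using LO.dim_subset_UNIV by (simp add: less_Suc_eq_le)
  ultimately have "\<exists>K. good K \<and> (\<forall>K'. good K' \<longrightarrow> L.dim K' \<le> L.dim K)"
    by (rule ex_has_greatest_nat)
  then obtain K where K: "good K" "\<And>K'. good K' \<Longrightarrow> L.dim K' \<le> L.dim K" by blast
  from K(1) obtain n where n: "flag K n = UNIV" by (auto simp: good_def)
  have Ks: "L.subspace K" "K \<subseteq> D" "\<And>x y. x \<in> K \<Longrightarrow> y \<in> K \<Longrightarrow> bracket x y \<in> K"
    "\<And>x. x \<in> D \<Longrightarrow> (\<And>v. act x v = 0) \<Longrightarrow> x \<in> K"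
    using K(1) by (auto simp: good_def)
  have "K = D"
  proof (rule ccontr)
    assume "K \<noteq> D"
    then have "K \<subset> D" using Ks(2) by blast
    then obtain h where h: "h \<in> D" "h \<notin> K" "\<And>k. k \<in> K \<Longrightarrow> bracket k h \<in> K"
      using engel_normalizer[OF D _ Ks(4) n] by blast
    obtain m where m: "\<And>v. (act h ^^ m) v = 0" using nil[OF h(1)] by blast
    define K' where "K' = {k + scaleL c h | k c. k \<in> K}"
    have KK': "K \<subseteq> K'"
    proof
      fix k assume "k \<in> K"
      then show "k \<in> K'" unfolding K'_def by (auto intro!: exI[of _ k] exI[of _ "0::complex"])
    qed
    have hK': "h \<in> K'"
      unfolding K'_def using L.subspace_0[OF Ks(1)] by (auto intro!: exI[of _ "0::'l"] exI[of _ "1::complex"])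
    have sub: "L.subspace K'"
    proof (rule L.subspaceI)
      show "0 \<in> K'" using KK' L.subspace_0[OF Ks(1)] by blast
      fix x y assume "x \<in> K'" "y \<in> K'"
      then obtain k c k' c' where "x = k + scaleL c h" "y = k' + scaleL c' h" "k \<in> K" "k' \<in> K"
        by (auto simp: K'_def)
      then show "x + y \<in> K'" unfolding K'_def
        using L.subspace_add[OF Ks(1)]
        by (auto intro!: exI[of _ "k + k'"] exI[of _ "c + c'"] simp: L.scale_left_distrib)
    next
      fix a x assume "x \<in> K'"
      then obtain k c where "x = k + scaleL c h" "k \<in> K" by (auto simp: K'_def)
      then show "scaleL a x \<in> K'" unfolding K'_def
        using L.subspace_scale[OF Ks(1)]
        by (auto intro!: exI[of _ "scaleL a k"] exI[of _ "a * c"] simp: L.scale_right_distrib)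
    qed
    have hk: "bracket h k \<in> K" if "k \<in> K" for k
      using L.subspace_neg[OF Ks(1) h(3)[OF that]] L.bracket_anti[of h k] by simp
    have closed: "bracket x y \<in> K" if xy: "x \<in> K'" "y \<in> K'" for x y
    proof -
      obtain k c k' c' where e: "x = k + scaleL c h" "y = k' + scaleL c' h" "k \<in> K" "k' \<in> K"
        using xy by (auto simp: K'_def)
      have "bracket x y = bracket k k' + scaleL c' (bracket k h) + scaleL c (bracket h k')"
        by (simp add: e(1,2) L.bracket_add L.bracket_scale L.bracket_self L.scale_right_distrib)
      then show ?thesis
        using e(3,4) Ks(3) h(3) hk by (simp add: L.subspace_add L.subspace_scale Ks(1))
    qed
    have "flag K' (m * n) = UNIV"
      using engel_extend[of K h m n, OF h(3) m] n by (auto simp: K'_def)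
    moreover have "K' \<subseteq> D"
      unfolding K'_def using Ks(2) h(1) D(1) by (auto intro!: L.subspace_add L.subspace_scale)
    ultimately have "good K'"
      unfolding good_def
    proof (intro conjI sub ballI impI)
      show "x \<in> K'" if "x \<in> D" "\<forall>v. act x v = 0" for x using Ks(4) KK' that by auto
      show "bracket x y \<in> K'" if "x \<in> K'" "y \<in> K'" for x y using closed[OF that] KK' by auto
    qed auto
    then have "K = K'"
      using LO.subspace_dim_equal[OF Ks(1) sub KK'] K(2) by blast
    then show False using h(2) hK' by blast
  qed
  then show ?thesis using n by blast
qed

text \<open>A commutator of two operators that lower the flag by \<open>Suc m\<close> lowers it by
  twice as much; one extra step is all that is kept.\<close>

lemma derived_series_flag:
  assumes I: "lie_ideal scaleL bracket I" and D: "D = derived_series scaleL bracket I 1"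
    and x: "x \<in> derived_series scaleL bracket I (Suc m)" and v: "v \<in> flag D j"
  shows "act x v \<in> flag D (j - Suc m)"
  using x v
proof (induction m arbitrary: x v j)
  case 0
  then show ?case using act_flag[of x D v j] D by simp
next
  case (Suc m)
  let ?S = "{x. \<forall>j. \<forall>v\<in>flag D j. act x v \<in> flag D (j - Suc (Suc m))}"
  have "L.subspace ?S"
    by (auto simp: L.subspace_def act_add act_scale
        intro!: M.subspace_0 M.subspace_add M.subspace_scale subspace_flag simp del: flag.simps)
  moreover have "bracket x y \<in> ?S" if xy: "x \<in> derived_series scaleL bracket I (Suc m)"
    "y \<in> derived_series scaleL bracket I (Suc m)" for x y
  proof -
    have "act a (act b v) \<in> flag D (j - Suc (Suc m))"
      if "a \<in> derived_series scaleL bracket I (Suc m)" "b \<in> derived_series scaleL bracket I (Suc m)"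
        "v \<in> flag D j" for a b v j
    proof -
      have "j - Suc m - Suc m \<le> j - Suc (Suc m)" by simp
      from flag_mono[OF this] show ?thesis using Suc.IH[OF that(1) Suc.IH[OF that(2,3)]] by blast
    qed
    then show ?thesis
      using xy by (auto simp: act_bracket intro!: M.subspace_diff subspace_flag simp del: flag.simps)
  qed
  ultimately have "derived_series scaleL bracket I (Suc (Suc m)) \<subseteq> ?S"
    unfolding derived_series.simps(2)[of _ _ _ "Suc m"] by (intro L.span_minimal) auto
  then show ?case using Suc.prems by blast
qed

section \<open>Trace forms and Cartan's criterion\<close>

lemma endo_act: "MO.endo (act x)"
  by (rule act_linear_right)

lemma commutator_act: "commutator (act x) (act y) = act (bracket x y)"
  by (simp add: commutator_def act_bracket fun_eq_iff)

definition trace_form :: "'l \<Rightarrow> 'l \<Rightarrow> complex" where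
  "trace_form x y = MO.trace (\<lambda>v. act x (act y v))"

lemma trace_form_linear:
  "trace_form (x + y) z = trace_form x z + trace_form y z"
  "trace_form (scaleL c x) z = c * trace_form x z"
  "trace_form z (x + y) = trace_form z x + trace_form z y"
  "trace_form z (scaleL c x) = c * trace_form z x"
  by (simp_all add: trace_form_def act_add act_scale MO.trace_add MO.trace_cmult)

lemma trace_form_sym: "trace_form x y = trace_form y x"
  unfolding trace_form_def by (rule MO.trace_comp_commute[OF endo_act endo_act])

lemma trace_form_zero [simp]: "trace_form 0 y = 0" "trace_form y 0 = 0"
  by (simp_all add: trace_form_def)

lemma trace_form_invariant: "trace_form (bracket x y) z = trace_form x (bracket y z)"
proof -
  have "MO.trace (\<lambda>v. act y (act x (act z v))) = MO.trace (\<lambda>v. act x (act z (act y v)))"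
    by (rule MO.trace_comp_commute[OF endo_act MO.endo_comp[OF endo_act endo_act]])
  then show ?thesis
    by (simp add: trace_form_def act_bracket act_diff MO.trace_diff)
qed

theorem cartan_criterion:
  assumes I: "lie_ideal scaleL bracket I"
    and tr: "\<And>x y z. x \<in> I \<Longrightarrow> y \<in> I \<Longrightarrow> z \<in> I \<Longrightarrow> trace_form x (bracket y z) = 0"
  shows "\<exists>n. \<forall>x\<in>derived_series scaleL bracket I n. \<forall>v. act x v = 0"
proof -
  define D where "D = derived_series scaleL bracket I 1"
  have D_eq: "D = L.span {bracket x y | x y. x \<in> I \<and> y \<in> I}" by (simp add: D_def)
  have DI: "D \<subseteq> I" unfolding D_eq by (rule L.derived_subset_ideal[OF I])
  have D: "L.subspace D" unfolding D_eq by (rule L.subspace_span)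
  have IID: "bracket x y \<in> D" if "x \<in> I" "y \<in> I" for x y
    unfolding D_eq by (rule L.span_base) (use that in blast)
  have trD: "trace_form a u = 0" if "a \<in> I" "u \<in> D" for a u
  proof -
    have "L.span {bracket x y | x y. x \<in> I \<and> y \<in> I} \<subseteq> {u. trace_form a u = 0}"
      by (rule L.span_minimal) (use that tr in \<open>auto simp: L.subspace_def trace_form_linear\<close>)
    then show ?thesis using that D_eq by blast
  qed
  have nil: "\<exists>n. \<forall>v. (act w ^^ n) v = 0" if w: "w \<in> D" for w
  proof -
    obtain y where y: "MO.endo y"
      and stable: "\<And>S T. Modules.module.subspace (fun_scale scaleM) S \<Longrightarrow>
        (\<And>U. U \<in> S \<Longrightarrow> commutator (act w) U \<in> S) \<Longrightarrow> MO.endo T \<Longrightarrow>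
        commutator (act w) T \<in> S \<Longrightarrow> commutator y T \<in> S"
      and nilp: "MO.trace (\<lambda>v. act w (y v)) = 0 \<Longrightarrow> \<exists>n. \<forall>v. (act w ^^ n) v = 0"
      by (rule MO.conjugate_semisimple_part[OF endo_act[of w]]) blast
    interpret F: vector_space "fun_scale scaleM :: complex \<Rightarrow> ('m \<Rightarrow> 'm) \<Rightarrow> _"
      by (rule M.vector_space_fun)
    have S: "F.subspace (act ` D)"
    proof (rule F.subspaceI)
      show "0 \<in> act ` D" using L.subspace_0[OF D] by (force simp: fun_eq_iff)
      show "f + g \<in> act ` D" if "f \<in> act ` D" "g \<in> act ` D" for f g
      proof -
        from that obtain a b where "f = act a" "g = act b" "a \<in> D" "b \<in> D" by blast
        then have "f + g = act (a + b)" "a + b \<in> D"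
          by (simp_all add: fun_eq_iff act_add L.subspace_add[OF D])
        then show ?thesis by blast
      qed
      show "fun_scale scaleM c f \<in> act ` D" if "f \<in> act ` D" for c f
      proof -
        from that obtain a where "f = act a" "a \<in> D" by blast
        then have "fun_scale scaleM c f = act (scaleL c a)" "scaleL c a \<in> D"
          by (simp_all add: fun_eq_iff fun_scale_def act_scale L.subspace_scale[OF D])
        then show ?thesis by blast
      qed
    qed
    have wI: "w \<in> I" using w DI by blast
    have yb: "\<exists>u\<in>D. commutator y (act b) = act u" if b: "b \<in> I" for b
    proof -
      have "commutator y (act b) \<in> act ` D"
      proof (rule stable[OF S _ endo_act])
        show "commutator (act w) U \<in> act ` D" if U: "U \<in> act ` D" for U
          using U DI IID[OF wI] by (auto simp: commutator_act)
        show "commutator (act w) (act b) \<in> act ` D"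
          using IID[OF wI b] by (auto simp: commutator_act)
      qed
      then show ?thesis by blast
    qed
    \<comment> \<open>Cyclicity moves \<open>y\<close> into a commutator: the trace of [a,b] y is
      minus the trace of a [y,b], and [y,b] acts as an element of \<open>D\<close>, to which
      \<open>a\<close> is orthogonal.\<close>
    have gen: "MO.trace (\<lambda>v. act (bracket a b) (y v)) = 0" if ab: "a \<in> I" "b \<in> I" for a b
    proof -
      obtain u where u: "u \<in> D" "commutator y (act b) = act u" using yb[OF ab(2)] by blast
      have "MO.trace (\<lambda>v. act b (act a (y v))) = MO.trace (\<lambda>v. act a (y (act b v)))"
        by (rule MO.trace_comp_commute[OF endo_act MO.endo_comp[OF endo_act y]])
      then have "MO.trace (\<lambda>v. act (bracket a b) (y v))
          = MO.trace (\<lambda>v. act a (act b (y v))) - MO.trace (\<lambda>v. act a (y (act b v)))"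
        by (simp add: act_bracket MO.trace_diff)
      also have "\<dots> = - MO.trace (\<lambda>v. act a (commutator y (act b) v))"
        by (simp add: commutator_def act_diff MO.trace_diff)
      also have "\<dots> = - trace_form a u" by (simp add: u(2) trace_form_def)
      finally show ?thesis using trD[OF ab(1) u(1)] by simp
    qed
    have "L.span {bracket x y | x y. x \<in> I \<and> y \<in> I} \<subseteq> {w. MO.trace (\<lambda>v. act w (y v)) = 0}"
      by (rule L.span_minimal)
        (use gen in \<open>auto simp: L.subspace_def act_add act_scale MO.trace_add MO.trace_cmult\<close>)
    then show ?thesis using nilp w D_eq by blast
  qed
  obtain n where n: "flag D n = UNIV"
    using engel[OF D _ nil] IID DI by blast
  have "act x v = 0" if "x \<in> derived_series scaleL bracket I (Suc n)" for x v
    using derived_series_flag[OF I D_def that, of v n] n by simp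
  then show ?thesis by blast
qed

end

section \<open>The Killing form and Whitehead's first lemma\<close>

context complex_fd_operators
begin

text \<open>The form is symmetric bilinear, not Hermitian, so null vectors may occur. Any non-null
  vector orthogonal to \<open>E\<close> could be normalised by a complex square root and added to
  \<open>E\<close>; by maximality only null vectors are left, and they form the null space of the
  form on \<open>I\<close>.\<close>

lemma maximal_orthonormal_set:
  assumes sym: "\<And>x y. \<beta> x y = \<beta> y x"
    and add: "\<And>x y z. \<beta> (x + y) z = \<beta> x z + \<beta> y z"
    and scale: "\<And>c x z. \<beta> (c *s x) z = c * \<beta> x z"
    and I: "subspace I"
  obtains E where "finite E" "E \<subseteq> I" "\<And>e e'. e \<in> E \<Longrightarrow> e' \<in> E \<Longrightarrow> \<beta> e e' = (if e = e' then 1 else 0)"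
    "\<And>x y. x \<in> I \<Longrightarrow> (\<And>e. e \<in> E \<Longrightarrow> \<beta> x e = 0) \<Longrightarrow> y \<in> I \<Longrightarrow> \<beta> x y = 0"
proof -
  define on where "on E \<longleftrightarrow> finite E \<and> E \<subseteq> I \<and>
    (\<forall>e\<in>E. \<forall>e'\<in>E. \<beta> e e' = (if e = e' then 1 else 0))" for E
  have add2: "\<beta> z (x + y) = \<beta> z x + \<beta> z y" and scale2: "\<beta> z (c *s x) = c * \<beta> z x" for c x y z
    using add[of x y z] scale[of c x z] by (simp_all add: sym)
  have zero: "\<beta> 0 z = 0" for z using scale[of 0 0 z] by simp
  have sum: "\<beta> (\<Sum>i\<in>A. u i *s h i) z = (\<Sum>i\<in>A. u i * \<beta> (h i) z)" for A :: "'b set" and u h z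
    by (induction A rule: infinite_finite_induct) (simp_all add: add scale zero)
  have pick: "(\<Sum>i\<in>E. u i * \<beta> i e) = u e" if "on E" "e \<in> E" for u E e
  proof -
    have "(\<Sum>i\<in>E. u i * \<beta> i e) = (\<Sum>i\<in>E. if i = e then u e else 0)"
      by (rule sum.cong) (use that in \<open>auto simp: on_def\<close>)
    then show ?thesis using that by (simp add: on_def)
  qed
  have indep: "card E < Suc dimension" if E: "on E" for E
  proof -
    have "independent E"
    proof (rule independent_if_scalars_zero)
      show "finite E" using E by (simp add: on_def)
      fix u x assume s: "(\<Sum>x\<in>E. u x *s x) = 0" and x: "x \<in> E"
      have "\<beta> (\<Sum>x\<in>E. u x *s x) x = u x" unfolding sum by (rule pick[OF E x])
      then show "u x = 0" by (simp add: s zero)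
    qed
    then show ?thesis
      using dim_subset_UNIV[of E] dim_eq_card_independent[of E] by simp
  qed
  have "\<exists>E. on E \<and> (\<forall>E'. on E' \<longrightarrow> card E' \<le> card E)"
  proof (rule ex_has_greatest_nat[where b = "Suc dimension"])
    show "on {}" by (simp add: on_def)
  qed (use indep in blast)
  then obtain E where E: "on E" and max: "\<And>E'. on E' \<Longrightarrow> card E' \<le> card E" by blast
  define N where "N = {x \<in> I. \<forall>e\<in>E. \<beta> x e = 0}"
  have null: "\<beta> x x = 0" if x: "x \<in> N" for x
  proof (rule ccontr)
    assume nz: "\<beta> x x \<noteq> 0"
    define r where "r = csqrt (\<beta> x x)"
    have r: "r * r = \<beta> x x" by (simp add: r_def power2_eq_square[symmetric])
    define z where "z = (1 / r) *s x"
    have r0: "r \<noteq> 0" using r nz by auto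
    have zz: "\<beta> z z = 1" using r nz r0 by (simp add: z_def scale scale2 field_simps)
    have ze: "\<beta> z e = 0" if "e \<in> E" for e using x that by (simp add: z_def scale N_def)
    then have "z \<notin> E" using zz by force
    have ez: "\<beta> e z = 0" if "e \<in> E" for e using ze[OF that] sym[of e z] by simp
    have "z \<in> I" unfolding z_def by (rule subspace_scale[OF I]) (use x in \<open>simp add: N_def\<close>)
    moreover have "\<beta> e e' = (if e = e' then 1 else 0)" if "e \<in> insert z E" "e' \<in> insert z E" for e e'
      using that E zz ze ez \<open>z \<notin> E\<close> unfolding on_def by (cases "e = z"; cases "e' = z") simp_all
    ultimately have "on (insert z E)" using E unfolding on_def by simp
    from max[OF this] show False using \<open>z \<notin> E\<close> E by (simp add: on_def)
  qed
  \<comment> \<open>Polarisation: \<open>N\<close> is closed under sums, and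
    \<open>\<beta> (x + y) (x + y)\<close> is twice \<open>\<beta> x y\<close>.\<close>
  have nn: "\<beta> x y = 0" if "x \<in> N" "y \<in> N" for x y
  proof -
    have "x + y \<in> N" using that subspace_add[OF I] by (auto simp: N_def add)
    from null[OF this] show ?thesis
      using null[OF that(1)] null[OF that(2)] sym[of y x] by (simp add: add add2)
  qed
  have perp: "\<beta> x y = 0" if x: "x \<in> N" and y: "y \<in> I" for x y
  proof -
    define n where "n = y - (\<Sum>e\<in>E. \<beta> y e *s e)"
    have EI: "E \<subseteq> I" using E by (simp add: on_def)
    have sI: "(\<Sum>e\<in>E. \<beta> y e *s e) \<in> I" using EI by (auto intro!: subspace_sum subspace_scale I)
    have y_eq: "y = n + (\<Sum>e\<in>E. \<beta> y e *s e)" by (simp add: n_def)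
    have "\<beta> y e = \<beta> n e + \<beta> (\<Sum>e\<in>E. \<beta> y e *s e) e" for e
      by (subst y_eq) (rule add)
    moreover have "\<beta> (\<Sum>e\<in>E. \<beta> y e *s e) e = \<beta> y e" if "e \<in> E" for e
      unfolding sum by (rule pick[OF E that])
    ultimately have "\<beta> n e = 0" if "e \<in> E" for e
      using that by (metis add_cancel_left_left)
    then have "n \<in> N" using subspace_diff[OF I y sI] by (simp add: N_def n_def[symmetric])
    then have "\<beta> n x = 0" using nn x by blast
    moreover have "\<beta> (\<Sum>e\<in>E. \<beta> y e *s e) x = 0"
      unfolding sum by (rule sum.neutral) (use x in \<open>simp add: N_def sym[of _ x]\<close>)
    ultimately have "\<beta> y x = 0" by (subst y_eq) (simp only: add add_0)
    then show ?thesis by (simp only: sym[of x y])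
  qed
  show ?thesis
  proof (rule that[of E])
    show "finite E" "E \<subseteq> I" "\<And>e e'. e \<in> E \<Longrightarrow> e' \<in> E \<Longrightarrow> \<beta> e e' = (if e = e' then 1 else 0)"
      using E by (auto simp: on_def)
    show "\<beta> x y = 0" if "x \<in> I" "\<And>e. e \<in> E \<Longrightarrow> \<beta> x e = 0" "y \<in> I" for x y
      by (rule perp) (use that in \<open>auto simp: N_def\<close>)
  qed
qed

end

section \<open>The Killing form of a semisimple Lie algebra and perfect ideals\<close>

locale semisimple_lie = lie_algebra scl bracket + LO: complex_fd_operators scl B
  for scl :: "complex \<Rightarrow> 'l::ab_group_add \<Rightarrow> 'l" and bracket B +
  assumes solvable_ideal_zero: "lie_ideal scl bracket I \<Longrightarrow> lie_solvable scl bracket I \<Longrightarrow> I = {0}"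
begin

sublocale ad: fd_lie_module scl bracket scl bracket B B
  by (intro fd_lie_module.intro adjoint_lie_module LO.complex_fd_operators_axioms)

lemma lie_idealI:
  "subspace I \<Longrightarrow> (\<And>x y. y \<in> I \<Longrightarrow> bracket x y \<in> I) \<Longrightarrow> lie_ideal scl bracket I"
  by (simp add: lie_ideal_def)

lemma abelian_ideal_zero:
  assumes I: "lie_ideal scl bracket I" and ab: "\<And>x y. x \<in> I \<Longrightarrow> y \<in> I \<Longrightarrow> bracket x y = 0"
  shows "I = {0}"
proof (rule solvable_ideal_zero[OF I])
  have "span {bracket x y | x y. x \<in> I \<and> y \<in> I} \<subseteq> {0}"
    by (rule span_minimal) (use ab in auto)
  moreover have "0 \<in> span {bracket x y | x y. x \<in> I \<and> y \<in> I}" by (rule span_zero)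
  ultimately have "derived_series scl bracket I 1 = {0}" by auto
  then show "lie_solvable scl bracket I" unfolding lie_solvable_def by blast
qed

lemma central_zero:
  assumes "\<And>y. bracket x y = 0"
  shows "x = 0"
proof -
  have "lie_ideal scl bracket {x. \<forall>y. bracket x y = 0}"
  proof (rule lie_idealI)
    fix a z assume z: "z \<in> {x. \<forall>y. bracket x y = 0}"
    then show "bracket a z \<in> {x. \<forall>y. bracket x y = 0}"
      using bracket_anti[of a z] by simp
  qed (simp add: subspace_def bracket_add bracket_scale)
  then have "{x. \<forall>y. bracket x y = 0} = {0}" by (rule abelian_ideal_zero) auto
  then show ?thesis using assms by blast
qed

text \<open>Cartan's criterion for the adjoint module puts a term of the derived series of
  \<open>I\<close> into the centre, which is zero. Hence \<open>I\<close> is solvable.\<close>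

lemma killing_zero_ideal:
  assumes I: "lie_ideal scl bracket I" and tr: "\<And>x y. x \<in> I \<Longrightarrow> y \<in> I \<Longrightarrow> ad.trace_form x y = 0"
  shows "I = {0}"
proof (rule solvable_ideal_zero[OF I])
  obtain n where n: "\<forall>x\<in>derived_series scl bracket I n. \<forall>v. bracket x v = 0"
    using ad.cartan_criterion[OF I] tr lie_idealD(2)[OF I] by blast
  then have "derived_series scl bracket I n \<subseteq> {0}" using central_zero by blast
  moreover have "0 \<in> derived_series scl bracket I n"
    using subspace_0[OF lie_idealD(1)[OF I]] by (cases n) (simp_all add: span_zero)
  ultimately show "lie_solvable scl bracket I" unfolding lie_solvable_def by blast
qed

text \<open>By invariance the null space of the form restricted to \<open>I\<close> is an ideal of
  the whole algebra, and the form vanishes on it.\<close>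

lemma killing_nondegenerate:
  assumes I: "lie_ideal scl bracket I" and x: "x \<in> I" "\<And>y. y \<in> I \<Longrightarrow> ad.trace_form x y = 0"
  shows "x = 0"
proof -
  let ?R = "{x \<in> I. \<forall>y\<in>I. ad.trace_form x y = 0}"
  have "lie_ideal scl bracket ?R"
  proof (rule lie_idealI)
    show "subspace ?R"
      using lie_idealD(1)[OF I] by (auto simp: subspace_def ad.trace_form_linear)
    fix a x assume x: "x \<in> ?R"
    have "ad.trace_form (bracket a x) y = 0" if "y \<in> I" for y
    proof -
      have "ad.trace_form (bracket a x) y = ad.trace_form (bracket y a) x"
        by (rule trans[OF ad.trace_form_sym ad.trace_form_invariant[symmetric]])
      also have "\<dots> = ad.trace_form x (bracket y a)" by (rule ad.trace_form_sym)
      also have "\<dots> = 0" using x lie_idealD(3)[OF I that] by blast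
      finally show ?thesis .
    qed
    then show "bracket a x \<in> ?R" using x lie_idealD(2)[OF I] by blast
  qed
  then have "?R = {0}" by (rule killing_zero_ideal) blast
  then show ?thesis using x by blast
qed

text \<open>The Killing form is nondegenerate on the derived ideal, so \<open>x\<close> has an
  orthogonal projection \<open>pr x\<close> to it. The remainder x - pr x is orthogonal to all
  brackets, hence central in \<open>I\<close>, and the centre of \<open>I\<close> is an abelian
  ideal.\<close>

lemma ideal_perfect:
  assumes I: "lie_ideal scl bracket I"
  shows "span {bracket x y | x y. x \<in> I \<and> y \<in> I} = I"
proof
  let ?D = "span {bracket x y | x y. x \<in> I \<and> y \<in> I}"
  show DI: "?D \<subseteq> I" by (rule derived_subset_ideal[OF I])
  have Did: "lie_ideal scl bracket ?D"
  proof (rule lie_idealI[OF subspace_span])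
    fix a d assume d: "d \<in> ?D"
    have "?D \<subseteq> {d. bracket a d \<in> ?D}"
    proof (rule span_minimal)
      show "subspace {d. bracket a d \<in> ?D}"
        by (auto simp: subspace_def bracket_add bracket_scale intro: span_zero span_add span_scale)
      show "{bracket x y | x y. x \<in> I \<and> y \<in> I} \<subseteq> {d. bracket a d \<in> ?D}"
      proof clarify
        fix x y assume xy: "x \<in> I" "y \<in> I"
        have "bracket a (bracket x y) = bracket (bracket a x) y + bracket x (bracket a y)"
          using ad.act_bracket[of a x y] by simp
        moreover have "bracket (bracket a x) y \<in> ?D" "bracket x (bracket a y) \<in> ?D"
          using xy lie_idealD(2)[OF I] by (blast intro: span_base)+
        ultimately show "bracket a (bracket x y) \<in> ?D" by (simp add: span_add)
      qed
    qed
    then show "bracket a d \<in> ?D" using d by blast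
  qed
  show "I \<subseteq> ?D"
  proof
    fix x assume x: "x \<in> I"
    obtain E where E: "finite E" "E \<subseteq> ?D"
      and on: "\<And>e e'. e \<in> E \<Longrightarrow> e' \<in> E \<Longrightarrow> ad.trace_form e e' = (if e = e' then 1 else 0)"
      and null: "\<And>x y. x \<in> ?D \<Longrightarrow> (\<And>e. e \<in> E \<Longrightarrow> ad.trace_form x e = 0) \<Longrightarrow> y \<in> ?D \<Longrightarrow> ad.trace_form x y = 0"
      by (rule LO.maximal_orthonormal_set[OF ad.trace_form_sym ad.trace_form_linear(1,2) subspace_span]) blast
    define pr where "pr x = (\<Sum>e\<in>E. scl (ad.trace_form x e) e)" for x
    have prD: "pr x \<in> ?D" for x unfolding pr_def using E(2) by (auto intro!: span_sum span_scale)
    have pre: "ad.trace_form (x - pr x) e = 0" if e: "e \<in> E" for x e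
    proof -
      have "ad.trace_form (\<Sum>e\<in>A. scl (u e) e) y = (\<Sum>e\<in>A. u e * ad.trace_form e y)" for A :: "'l set" and u y
        by (induction A rule: infinite_finite_induct) (simp_all add: ad.trace_form_linear)
      then have "ad.trace_form (pr x) e = (\<Sum>e'\<in>E. ad.trace_form x e' * ad.trace_form e' e)"
        by (simp add: pr_def)
      also have "\<dots> = (\<Sum>e'\<in>E. if e' = e then ad.trace_form x e else 0)"
        by (rule sum.cong) (auto simp: on e)
      also have "\<dots> = ad.trace_form x e" using E(1) e by simp
      finally show ?thesis
        using ad.trace_form_linear(1)[of "x - pr x" "pr x" e] by simp
    qed
    have D_eq: "d = pr d" if d: "d \<in> ?D" for d
    proof -
      have dD: "d - pr d \<in> ?D" by (rule span_diff[OF d prD])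
      have "d - pr d = 0"
        by (rule killing_nondegenerate[OF Did dD]) (rule null[OF dD pre])
      then show ?thesis by simp
    qed
    let ?y = "x - pr x"
    have yI: "?y \<in> I" using subspace_diff[OF lie_idealD(1)[OF I] x] prD DI by blast
    have yD: "ad.trace_form ?y d = 0" if "d \<in> ?D" for d
    proof -
      have "ad.trace_form ?y (\<Sum>e\<in>A. scl (u e) e) = (\<Sum>e\<in>A. u e * ad.trace_form ?y e)" for A :: "'l set" and u
        by (induction A rule: infinite_finite_induct) (simp_all add: ad.trace_form_linear)
      from this[of "ad.trace_form d" E]
      have "ad.trace_form ?y (pr d) = (\<Sum>e\<in>E. ad.trace_form d e * ad.trace_form ?y e)"
        by (simp only: pr_def[of d])
      also have "\<dots> = 0" by (rule sum.neutral) (simp add: pre)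
      finally show ?thesis using D_eq[OF that] by simp
    qed
    \<comment> \<open>Invariance rewrites the pairing of [y,u] with v as that of y with [u,v], which
      lies in the derived ideal.\<close>
    have yu: "bracket ?y u = 0" if u: "u \<in> I" for u
    proof (rule killing_nondegenerate[OF I])
      show "bracket ?y u \<in> I" by (rule lie_idealD(2)[OF I u])
      show "ad.trace_form (bracket ?y u) v = 0" if "v \<in> I" for v
        unfolding ad.trace_form_invariant by (rule yD) (use u that in \<open>blast intro: span_base\<close>)
    qed
    let ?Z = "{y \<in> I. \<forall>u\<in>I. bracket y u = 0}"
    have "lie_ideal scl bracket ?Z"
    proof (rule lie_idealI)
      show "subspace ?Z"
        using lie_idealD(1)[OF I] by (auto simp: subspace_def bracket_add bracket_scale)
      fix a y assume y: "y \<in> ?Z"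
      have "bracket (bracket a y) u = 0" if "u \<in> I" for u
        using ad.act_bracket[of a y u] y that lie_idealD(2)[OF I] by simp
      then show "bracket a y \<in> ?Z" using y lie_idealD(2)[OF I] by blast
    qed
    then have "?Z = {0}" by (rule abelian_ideal_zero) blast
    then have "?y = 0" using yI yu by blast
    then show "x \<in> ?D" using prD[of x] by simp
  qed
qed

end

section \<open>Casimir operators and cocycles\<close>

locale semisimple_module = semisimple_lie scl bracket B + fd_lie_module scl bracket scaleM act B BM
  for scl :: "complex \<Rightarrow> 'l::ab_group_add \<Rightarrow> 'l" and bracket B
    and scaleM :: "complex \<Rightarrow> 'm::ab_group_add \<Rightarrow> 'm" and act BM
begin

definition cocycle :: "('l \<Rightarrow> 'm) \<Rightarrow> bool" where
  "cocycle f \<longleftrightarrow> Vector_Spaces.linear scl scaleM f \<and>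
    (\<forall>x y. f (bracket x y) = act x (f y) - act y (f x))"

lemma cocycleD:
  assumes "cocycle f"
  shows "f (x + y) = f x + f y" "f (scl c x) = scaleM c (f x)"
    "f (bracket x y) = act x (f y) - act y (f x)"
  using assms unfolding cocycle_def Vector_Spaces.linear_iff by blast+

lemma derived_series_ideal:
  assumes "lie_ideal scl bracket I"
  shows "derived_series scl bracket I n = I"
  by (induction n) (simp_all add: ideal_perfect[OF assms])

text \<open>Cartan's criterion only reaches some term of the derived series, but for a perfect ideal
  every term is the ideal itself.\<close>

lemma trace_null_ideal_acts_trivially:
  assumes I: "lie_ideal scl bracket I" and "\<And>x y. x \<in> I \<Longrightarrow> y \<in> I \<Longrightarrow> trace_form x y = 0" and x: "x \<in> I"
  shows "act x v = 0"
proof -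
  have "\<exists>n. \<forall>x\<in>derived_series scl bracket I n. \<forall>v. act x v = 0"
    by (rule cartan_criterion[OF I]) (use assms(2) lie_idealD(2)[OF I] in blast)
  then show ?thesis using x derived_series_ideal[OF I] by simp
qed

text \<open>The cocycle identity makes \<open>f\<close> vanish on brackets of elements of
  \<open>I\<close>, and these span \<open>I\<close>.\<close>

lemma cocycle_trivial_ideal:
  assumes I: "lie_ideal scl bracket I" and triv: "\<And>x v. x \<in> I \<Longrightarrow> act x v = 0"
    and f: "cocycle f" and x: "x \<in> I"
  shows "f x = 0"
proof -
  have "f 0 = 0" using cocycleD(2)[OF f, of 0 0] by simp
  then have "span {bracket x y | x y. x \<in> I \<and> y \<in> I} \<subseteq> {x. f x = 0}"
    by (intro span_minimal) (auto simp: subspace_def cocycleD[OF f] triv)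
  then show ?thesis using x ideal_perfect[OF I] by blast
qed

text \<open>The null space of the trace form of the module, not the solvable radical.\<close>

definition radical :: "'l set" where
  "radical = {x. \<forall>y. trace_form x y = 0}"

lemma lie_ideal_radical: "lie_ideal scl bracket radical"
proof (rule lie_idealI)
  show "subspace radical"
    by (auto simp: radical_def subspace_def trace_form_linear)
  fix a x assume x: "x \<in> radical"
  have "trace_form (bracket a x) y = trace_form (bracket y a) x" for y
    by (rule trans[OF trace_form_sym trace_form_invariant[symmetric]])
  then show "bracket a x \<in> radical" using x by (simp add: radical_def trace_form_sym[of _ x])
qed

lemma act_radical: "x \<in> radical \<Longrightarrow> act x v = 0"
  by (rule trace_null_ideal_acts_trivially[OF lie_ideal_radical]) (auto simp: radical_def)

text \<open>An orthonormal set is its own dual basis, so the Casimir operator becomes a sum of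
  squares. Expansions are required only modulo the null space of the form.\<close>

definition casimir_set :: "'l set \<Rightarrow> bool" where
  "casimir_set E \<longleftrightarrow> finite E \<and> (\<forall>e\<in>E. \<forall>e'\<in>E. trace_form e e' = (if e = e' then 1 else 0)) \<and>
    (\<forall>x. \<exists>n\<in>radical. x = (\<Sum>e\<in>E. scl (trace_form x e) e) + n)"

lemma casimir_set_exists: "\<exists>E. casimir_set E"
proof -
  obtain E where E: "finite E" "E \<subseteq> UNIV"
    and on: "\<And>e e'. e \<in> E \<Longrightarrow> e' \<in> E \<Longrightarrow> trace_form e e' = (if e = e' then 1 else 0)"
    and null: "\<And>x y. x \<in> UNIV \<Longrightarrow> (\<And>e. e \<in> E \<Longrightarrow> trace_form x e = 0) \<Longrightarrow> y \<in> UNIV \<Longrightarrow> trace_form x y = 0"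
    by (rule LO.maximal_orthonormal_set[OF trace_form_sym trace_form_linear(1,2) subspace_UNIV]) blast
  have "\<exists>n\<in>radical. x = (\<Sum>e\<in>E. scl (trace_form x e) e) + n" for x
  proof
    let ?s = "\<Sum>e\<in>E. scl (trace_form x e) e"
    show "x = ?s + (x - ?s)" by simp
    have "trace_form (x - ?s) e = 0" if e: "e \<in> E" for e
    proof -
      have "trace_form (\<Sum>e\<in>A. scl (u e) e) y = (\<Sum>e\<in>A. u e * trace_form e y)" for A :: "'l set" and u y
        by (induction A rule: infinite_finite_induct) (simp_all add: trace_form_linear)
      then have "trace_form ?s e = (\<Sum>e'\<in>E. trace_form x e' * trace_form e' e)" by simp
      also have "\<dots> = (\<Sum>e'\<in>E. if e' = e then trace_form x e else 0)"
        by (rule sum.cong) (auto simp: on e)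
      also have "\<dots> = trace_form x e" using E(1) e by simp
      finally show ?thesis using trace_form_linear(1)[of "x - ?s" ?s e] by simp
    qed
    then have "trace_form (x - ?s) y = 0" for y by (rule null[OF UNIV_I _ UNIV_I])
    then show "x - ?s \<in> radical" unfolding radical_def by blast
  qed
  then show ?thesis unfolding casimir_set_def by (intro exI[of _ E] conjI ballI allI E on)
qed

text \<open>The tensor formed by the sum of all e \<otimes> e is invariant: by invariance of the
  form, \<open>bracket x\<close> has a skew matrix in the orthonormal set. A general bilinear
  \<open>g\<close> covers both the Casimir operator and its analogue for a cocycle.\<close>

lemma casimir_invariant:
  assumes E: "casimir_set E"
    and g1: "\<And>a b c. g (a + b) c = g a c + g b c" "\<And>k a c. g (scl k a) c = scaleM k (g a c)"
    and g2: "\<And>a b c. g c (a + b) = g c a + g c b" "\<And>k a c. g c (scl k a) = scaleM k (g c a)"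
    and rad: "\<And>n a. n \<in> radical \<Longrightarrow> g n a = 0" "\<And>n a. n \<in> radical \<Longrightarrow> g a n = 0"
  shows "(\<Sum>e\<in>E. g (bracket x e) e + g e (bracket x e)) = 0"
proof -
  have z: "g 0 a = 0" "g a 0 = 0" for a using g1(2)[of 0 0 a] g2(2)[of a 0 0] by simp_all
  have gs: "g (\<Sum>e\<in>A. scl (u e) e) a = (\<Sum>e\<in>A. scaleM (u e) (g e a))"
    "g a (\<Sum>e\<in>A. scl (u e) e) = (\<Sum>e\<in>A. scaleM (u e) (g a e))" for A :: "'l set" and u a
    by (induction A rule: infinite_finite_induct) (simp_all add: g1 g2 z)
  let ?t = "\<lambda>e e'. trace_form (bracket x e) e'"
  have expand: "g (bracket x e) a = (\<Sum>e'\<in>E. scaleM (?t e e') (g e' a))"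
    "g a (bracket x e) = (\<Sum>e'\<in>E. scaleM (?t e e') (g a e'))" for e a
  proof -
    obtain n where n: "n \<in> radical" "bracket x e = (\<Sum>e'\<in>E. scl (?t e e') e') + n"
      using E unfolding casimir_set_def by blast
    show "g (bracket x e) a = (\<Sum>e'\<in>E. scaleM (?t e e') (g e' a))"
      by (subst n(2)) (simp add: g1(1) gs rad(1)[OF n(1)])
    show "g a (bracket x e) = (\<Sum>e'\<in>E. scaleM (?t e e') (g a e'))"
      by (subst n(2)) (simp add: g2(1) gs rad(2)[OF n(1)])
  qed
  have anti: "?t e e' = - ?t e' e" for e e'
  proof -
    have "bracket x e = scl (- 1) (bracket e x)" using bracket_anti[of x e] by simp
    then have "?t e e' = - trace_form (bracket e x) e'" by (simp only: trace_form_linear) simp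
    also have "\<dots> = - trace_form e (bracket x e')" by (simp only: trace_form_invariant)
    finally show ?thesis by (simp only: trace_form_sym)
  qed
  have "(\<Sum>e\<in>E. g e (bracket x e)) = (\<Sum>e\<in>E. \<Sum>e'\<in>E. scaleM (?t e e') (g e e'))"
    by (simp only: expand)
  also have "\<dots> = (\<Sum>e\<in>E. \<Sum>e'\<in>E. scaleM (?t e' e) (g e' e))" by (rule sum.swap)
  also have "\<dots> = - (\<Sum>e\<in>E. g (bracket x e) e)"
    by (subst anti) (simp only: expand M.scale_minus_left sum_negf)
  finally show ?thesis by (simp add: sum.distrib)
qed

lemma casimir_commutes:
  assumes E: "casimir_set E"
  shows "act x (\<Sum>e\<in>E. act e (act e v)) = (\<Sum>e\<in>E. act e (act e (act x v)))"
proof -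
  have "(\<Sum>e\<in>E. act (bracket x e) (act e v) + act e (act (bracket x e) v)) = 0"
    by (rule casimir_invariant[OF E]) (simp_all add: act_add act_scale act_radical)
  then have "(\<Sum>e\<in>E. act x (act e (act e v)) - act e (act e (act x v))) = 0"
    by (simp add: act_bracket act_diff)
  then show ?thesis by (simp add: sum_subtractf act_sum)
qed

text \<open>With m the sum of all \<open>act e (f e)\<close>, this reads c (f x) = x m for the
  Casimir operator c. Where c is invertible, \<open>f\<close> is therefore the coboundary of the
  preimage of m.\<close>

lemma casimir_cocycle:
  assumes E: "casimir_set E" and f: "cocycle f"
  shows "act x (\<Sum>e\<in>E. act e (f e)) = (\<Sum>e\<in>E. act e (act e (f x)))"
proof -
  have "(\<Sum>e\<in>E. act (bracket x e) (f e) + act e (f (bracket x e))) = 0"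
    by (rule casimir_invariant[OF E])
      (simp_all add: act_add act_scale act_radical cocycleD(1,2)[OF f]
        cocycle_trivial_ideal[OF lie_ideal_radical act_radical f])
  then have "(\<Sum>e\<in>E. act x (act e (f e)) - act e (act e (f x))) = 0"
    by (simp add: act_bracket act_diff cocycleD(3)[OF f])
  then show ?thesis by (simp add: sum_subtractf act_sum)
qed

text \<open>The idempotent \<open>q\<close> below projects onto the part where the Casimir operator \<open>c\<close> is invertible.
  Instead of passing to the submodule \<open>ker q\<close>, we keep the space and replace the action \<open>\<rho>\<close> by
  \<open>(1 - q) \<rho>\<close>, which shrinks the span of its images.\<close>

lemma fitting_step:
  assumes f: "cocycle f"
    and IH: "\<And>act' f'. semisimple_module scl bracket B scaleM act' BM \<Longrightarrow>
      semisimple_module.cocycle scl bracket scaleM act' f' \<Longrightarrow>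
      M.dim (M.span (\<Union>x. range (act' x))) < M.dim (M.span (\<Union>x. range (act x))) \<Longrightarrow>
      \<exists>m. \<forall>x. f' x = act' x m"
  shows "\<exists>m. \<forall>x. f x = act x m"
proof -
  obtain E where E: "casimir_set E" using casimir_set_exists by blast
  define c where "c v = (\<Sum>e\<in>E. act e (act e v))" for v
  have c: "MO.endo c" unfolding c_def
    by (rule MO.endo_sum_map) (rule MO.endo_comp[OF endo_act endo_act])
  have cx: "act x (c v) = c (act x v)" for x v
    unfolding c_def by (rule casimir_commutes[OF E])
  define m where "m = (\<Sum>e\<in>E. act e (f e))"
  have cf: "c (f x) = act x m" for x
    unfolding c_def m_def by (rule casimir_cocycle[OF E f, symmetric])
  show ?thesis
  proof (cases "E = {}")
    case True
    \<comment> \<open>With \<open>E\<close> empty the expansion has no terms, so the whole algebra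
      acts trivially, and by perfectness a cocycle is zero.\<close>
    have "x \<in> radical" for x using E True by (auto simp: casimir_set_def)
    then show ?thesis
      using cocycle_trivial_ideal[OF lie_ideal_radical act_radical f] by (auto simp: act_radical)
  next
    case False
    have "MO.trace c = (\<Sum>e\<in>E. trace_form e e)"
      by (simp add: c_def[abs_def] MO.trace_sum trace_form_def)
    also have "\<dots> = (\<Sum>e\<in>E. 1)"
      by (rule sum.cong) (use E in \<open>auto simp: casimir_set_def\<close>)
    finally have tr: "MO.trace c \<noteq> 0" using E False by (simp add: casimir_set_def)
    obtain g N where idem: "\<And>v. c (MO.poly_op g c (c (MO.poly_op g c v))) = c (MO.poly_op g c v)"
      and nil: "\<And>v. (c ^^ N) (v - c (MO.poly_op g c v)) = 0"
      by (rule MO.fitting[OF c]) blast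
    define h where "h = MO.poly_op g c"
    define q where "q v = c (h v)" for v
    have h: "MO.endo h" unfolding h_def by (rule MO.endo_poly_op[OF c])
    have q: "MO.endo q" unfolding q_def by (rule MO.endo_comp[OF c h])
    have hx: "act x (h v) = h (act x v)" for x v
      unfolding h_def by (rule MO.poly_op_commute[where f = c and g = "act x", OF c endo_act cx])
    have hc: "c (h v) = h (c v)" for v
      unfolding h_def by (rule MO.poly_op_commute[where f = c and g = c, OF c c refl])
    have qx: "act x (q v) = q (act x v)" for x v by (simp add: q_def cx hx)
    have qq: "q (q v) = q v" for v using idem by (simp add: q_def h_def)
    define p where "p v = v - q v" for v
    have p: "MO.endo p" unfolding p_def by (rule MO.endo_minus[OF MO.endo_id q])
    have px: "act x (p v) = p (act x v)" for x v by (simp add: p_def act_diff qx)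
    have pp: "p (p v) = p v" for v by (simp add: p_def MO.endo_diff[OF q] qq)
    have qp: "q (p v) = 0" for v by (simp add: p_def MO.endo_diff[OF q] qq)
    define act' where "act' x v = p (act x v)" for x v
    have "lie_module scl bracket scaleM act'"
    proof (rule lie_module.intro[OF lie_algebra_axioms M.vector_space_axioms], rule lie_module_axioms.intro)
      show "Vector_Spaces.linear scl scaleM (\<lambda>x. act' x m)" for m
        using act_linear_left[of m] by (simp add: act'_def Vector_Spaces.linear_iff act_add
            act_scale MO.endo_add[OF p] MO.endo_scale[OF p])
      show "Vector_Spaces.linear scaleM scaleM (act' x)" for x
        unfolding act'_def by (rule MO.endo_comp[OF p endo_act])
      show "act' (bracket x y) m = act' x (act' y m) - act' y (act' x m)" for x y m
        by (simp add: act'_def act_bracket px pp MO.endo_diff[OF p])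
    qed
    then have sm: "semisimple_module scl bracket B scaleM act' BM"
      by (intro semisimple_module.intro fd_lie_module.intro semisimple_lie_axioms
          LO.complex_fd_operators_axioms MO.complex_fd_operators_axioms)
    interpret S: semisimple_module scl bracket B scaleM act' BM by (rule sm)
    have "S.cocycle (\<lambda>x. p (f x))"
      using f unfolding S.cocycle_def cocycle_def
      by (simp add: Vector_Spaces.linear_iff MO.endo_add[OF p] MO.endo_scale[OF p] act'_def
          MO.endo_diff[OF p] px pp)
    \<comment> \<open>If the span did not shrink, \<open>q\<close> would vanish on every
      \<open>c v\<close>. As \<open>q\<close> is idempotent of the form c h, it would be zero, and
      \<open>c\<close> would be nilpotent despite its nonzero trace.\<close>
    moreover have "M.dim (M.span (\<Union>x. range (act' x))) < M.dim (M.span (\<Union>x. range (act x)))"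
    proof (rule ccontr)
      let ?W = "M.span (\<Union>x. range (act x))" and ?W' = "M.span (\<Union>x. range (act' x))"
      assume "\<not> M.dim ?W' < M.dim ?W"
      then have le: "M.dim ?W \<le> M.dim ?W'" by simp
      have "?W' \<subseteq> ?W"
        by (rule M.span_mono) (auto simp: act'_def px[symmetric])
      then have WW: "?W' = ?W"
        by (rule MO.subspace_dim_equal[OF M.subspace_span M.subspace_span _ le])
      have "?W' \<subseteq> {v. q v = 0}"
        by (rule M.span_minimal)
          (auto simp: act'_def qp M.subspace_def MO.endo_add[OF q] MO.endo_scale[OF q] MO.endo_zero[OF q])
      moreover have "c v \<in> ?W" for v
        unfolding c_def by (intro M.span_sum M.span_base) blast
      ultimately have "q (c v) = 0" for v using WW by blast
      then have "q v = 0" for v using qq[of v] by (simp add: q_def)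
      then have "(c ^^ N) v = 0" for v using nil[of v] by (simp add: q_def h_def)
      then have "MO.trace c = 0" by (rule MO.trace_nilpotent[OF c])
      then show False using tr by contradiction
    qed
    ultimately obtain m' where m': "\<And>x. p (f x) = act' x m'" using IH[OF sm] by blast
    \<comment> \<open>On the range of \<open>q\<close> the operator \<open>h\<close> inverts
      \<open>c\<close>, so \<open>h m\<close> solves the equation there. On the range of
      \<open>p\<close> the induction hypothesis gives \<open>m'\<close>, which \<open>p\<close>
      moves into that range.\<close>
    have "f x = act x (h m + p m')" for x
    proof -
      have "f x = q (f x) + p (f x)" by (simp add: p_def)
      also have "q (f x) = act x (h m)" by (simp add: q_def hc cf hx)
      also have "p (f x) = act x (p m')" by (simp add: m' act'_def px)
      finally show ?thesis by (simp add: act_add)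
    qed
    then show ?thesis by blast
  qed
qed

end

text \<open>The induction is on the dimension of the span of all images of the action, because the
  underlying space stays the same while the action shrinks.\<close>

theorem whitehead_first_lemma:
  assumes "semisimple_module scl bracket B scaleM act BM"
    and "semisimple_module.cocycle scl bracket scaleM act f"
  shows "\<exists>m. \<forall>x. f x = act x m"
  using assms
proof (induction "vector_space.dim scaleM (Modules.module.span scaleM (\<Union>x. range (act x)))"
    arbitrary: act f rule: less_induct)
  case less
  show ?case
  proof (rule semisimple_module.fitting_step[OF less.prems])
    fix act' :: "'a \<Rightarrow> 'b \<Rightarrow> 'b" and f'
    assume "semisimple_module scl bracket B scaleM act' BM"
      and "semisimple_module.cocycle scl bracket scaleM act' f'"
      and "vector_space.dim scaleM (Modules.module.span scaleM (\<Union>x. range (act' x)))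
        < vector_space.dim scaleM (Modules.module.span scaleM (\<Union>x. range (act x)))"
    then show "\<exists>m. \<forall>x. f' x = act' x m" by (intro less.hyps)
  qed
qed

section \<open>Isomorphisms between subspaces and quotients\<close>

lemma vs_isomorphicI:
  assumes "vectorspace class_ring A" "vectorspace class_ring B"
    and "\<And>x. x \<in> carrier A \<Longrightarrow> \<phi> x \<in> carrier B"
    and "\<And>x y. x \<in> carrier A \<Longrightarrow> y \<in> carrier A \<Longrightarrow> \<phi> (x \<oplus>\<^bsub>A\<^esub> y) = \<phi> x \<oplus>\<^bsub>B\<^esub> \<phi> y"
    and "\<And>c x. x \<in> carrier A \<Longrightarrow> \<phi> (c \<odot>\<^bsub>A\<^esub> x) = c \<odot>\<^bsub>B\<^esub> \<phi> x"
    and "bij_betw \<phi> (carrier A) (carrier B)"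
  shows "vs_isomorphic A B"
proof -
  have "linear_map class_ring A B \<phi>"
    by (intro linear_map.intro mod_hom.intro mod_hom_axioms.intro assms(1,2)
        vectorspace.axioms(1)[OF assms(1)] vectorspace.axioms(1)[OF assms(2)])
      (use assms(3-5) in \<open>auto simp: module_hom_def\<close>)
  then show ?thesis using assms(6) unfolding vs_isomorphic_def by blast
qed

lemma vs_isomorphicE:
  assumes "vs_isomorphic A B"
  obtains \<phi> where "vectorspace class_ring A" "vectorspace class_ring B"
    "\<And>x. x \<in> carrier A \<Longrightarrow> \<phi> x \<in> carrier B"
    "\<And>x y. x \<in> carrier A \<Longrightarrow> y \<in> carrier A \<Longrightarrow> \<phi> (x \<oplus>\<^bsub>A\<^esub> y) = \<phi> x \<oplus>\<^bsub>B\<^esub> \<phi> y"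
    "\<And>c x. x \<in> carrier A \<Longrightarrow> \<phi> (c \<odot>\<^bsub>A\<^esub> x) = c \<odot>\<^bsub>B\<^esub> \<phi> x"
    "bij_betw \<phi> (carrier A) (carrier B)"
proof -
  note result = that
  obtain \<phi> where \<phi>: "linear_map class_ring A B \<phi>" "bij_betw \<phi> (carrier A) (carrier B)"
    using assms unfolding vs_isomorphic_def by blast
  have hom: "\<phi> \<in> LinearCombinations.module_hom class_ring A B"
    by (rule mod_hom.f_hom[OF linear_map.axioms(3)[OF \<phi>(1)]])
  show thesis
    by (rule result[OF linear_map.axioms(1,2)[OF \<phi>(1)] _ _ _ \<phi>(2)])
      (use hom in \<open>auto simp: module_hom_def\<close>)
qed

lemma vs_isomorphic_sym:
  assumes "vs_isomorphic A B"
  shows "vs_isomorphic B A"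
proof -
  obtain \<phi> where A: "vectorspace class_ring A" and B: "vectorspace class_ring B"
    and cl: "\<And>x. x \<in> carrier A \<Longrightarrow> \<phi> x \<in> carrier B"
    and add: "\<And>x y. x \<in> carrier A \<Longrightarrow> y \<in> carrier A \<Longrightarrow> \<phi> (x \<oplus>\<^bsub>A\<^esub> y) = \<phi> x \<oplus>\<^bsub>B\<^esub> \<phi> y"
    and smult: "\<And>c x. x \<in> carrier A \<Longrightarrow> \<phi> (c \<odot>\<^bsub>A\<^esub> x) = c \<odot>\<^bsub>B\<^esub> \<phi> x"
    and bij: "bij_betw \<phi> (carrier A) (carrier B)"
    by (rule vs_isomorphicE[OF assms]) blast
  interpret A: vectorspace class_ring A by (rule A)
  define \<psi> where "\<psi> = the_inv_into (carrier A) \<phi>"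
  have inj: "inj_on \<phi> (carrier A)" using bij by (rule bij_betw_imp_inj_on)
  have \<psi>: "\<psi> y \<in> carrier A" "\<phi> (\<psi> y) = y" if "y \<in> carrier B" for y
    using that bij the_inv_into_into[OF inj, of y] f_the_inv_into_f[OF inj, of y]
    by (auto simp: \<psi>_def bij_betw_def)
  have eq: "\<psi> y = x" if "x \<in> carrier A" "\<phi> x = y" for x y
    using the_inv_into_f_f[OF inj that(1)] that(2) by (simp add: \<psi>_def)
  show ?thesis
  proof (rule vs_isomorphicI[OF B A])
    show "\<psi> x \<in> carrier A" if "x \<in> carrier B" for x by (rule \<psi>(1)[OF that])
    show "\<psi> (x \<oplus>\<^bsub>B\<^esub> y) = \<psi> x \<oplus>\<^bsub>A\<^esub> \<psi> y" if "x \<in> carrier B" "y \<in> carrier B" for x y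
      by (rule eq) (use that \<psi> add in simp_all)
    show "\<psi> (c \<odot>\<^bsub>B\<^esub> x) = c \<odot>\<^bsub>A\<^esub> \<psi> x" if "x \<in> carrier B" for c x
    proof (rule eq)
      show "c \<odot>\<^bsub>A\<^esub> \<psi> x \<in> carrier A"
        by (rule A.smult_closed) (simp_all add: \<psi>(1)[OF that] class_ring_simps)
      show "\<phi> (c \<odot>\<^bsub>A\<^esub> \<psi> x) = c \<odot>\<^bsub>B\<^esub> x" by (simp only: smult[OF \<psi>(1)[OF that]] \<psi>(2)[OF that])
    qed
    show "bij_betw \<psi> (carrier B) (carrier A)"
      unfolding \<psi>_def by (rule bij_betw_the_inv_into[OF bij])
  qed
qed

lemma vs_isomorphic_trans:
  assumes "vs_isomorphic A B" "vs_isomorphic B C"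
  shows "vs_isomorphic A C"
proof -
  obtain \<phi> where A: "vectorspace class_ring A"
    and \<phi>: "\<And>x. x \<in> carrier A \<Longrightarrow> \<phi> x \<in> carrier B"
    "\<And>x y. x \<in> carrier A \<Longrightarrow> y \<in> carrier A \<Longrightarrow> \<phi> (x \<oplus>\<^bsub>A\<^esub> y) = \<phi> x \<oplus>\<^bsub>B\<^esub> \<phi> y"
    "\<And>c x. x \<in> carrier A \<Longrightarrow> \<phi> (c \<odot>\<^bsub>A\<^esub> x) = c \<odot>\<^bsub>B\<^esub> \<phi> x"
    and bij1: "bij_betw \<phi> (carrier A) (carrier B)"
    by (rule vs_isomorphicE[OF assms(1)]) blast
  obtain \<psi> where C: "vectorspace class_ring C"
    and \<psi>: "\<And>x. x \<in> carrier B \<Longrightarrow> \<psi> x \<in> carrier C"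
    "\<And>x y. x \<in> carrier B \<Longrightarrow> y \<in> carrier B \<Longrightarrow> \<psi> (x \<oplus>\<^bsub>B\<^esub> y) = \<psi> x \<oplus>\<^bsub>C\<^esub> \<psi> y"
    "\<And>c x. x \<in> carrier B \<Longrightarrow> \<psi> (c \<odot>\<^bsub>B\<^esub> x) = c \<odot>\<^bsub>C\<^esub> \<psi> x"
    and bij2: "bij_betw \<psi> (carrier B) (carrier C)"
    by (rule vs_isomorphicE[OF assms(2)]) blast
  show ?thesis
    by (rule vs_isomorphicI[OF A C, of "\<psi> \<circ> \<phi>"])
      (simp_all add: \<phi> \<psi> bij_betw_trans[OF bij1 bij2])
qed

context vector_space
begin

lemma coset_eq_iff:
  assumes W: "subspace W"
  shows "u +o W = v +o W \<longleftrightarrow> u - v \<in> W"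
proof
  assume "u +o W = v +o W"
  moreover have "u \<in> u +o W" using subspace_0[OF W] by (auto simp: elt_set_plus_def)
  ultimately obtain w where "w \<in> W" "u = v + w" by (auto simp: elt_set_plus_def)
  then show "u - v \<in> W" by simp
next
  have sub: "a +o W \<subseteq> b +o W" if ab: "a - b \<in> W" for a b
  proof
    fix z assume "z \<in> a +o W"
    then obtain w where "w \<in> W" "z = a + w" by (auto simp: elt_set_plus_def)
    then have "(a - b) + w \<in> W" "z = b + ((a - b) + w)" using subspace_add[OF W ab] by simp_all
    then show "z \<in> b +o W" unfolding elt_set_plus_def by blast
  qed
  assume uv: "u - v \<in> W"
  then have "v - u \<in> W" using subspace_neg[OF W uv] by simp
  then show "u +o W = v +o W" using sub[OF uv] sub by blast
qed

lemma coset_add: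
  assumes W: "subspace W"
  shows "(u +o W) + (v +o W) = (u + v) +o W"
proof (intro equalityI subsetI)
  fix z assume "z \<in> (u +o W) + (v +o W)"
  then obtain w w' where "w \<in> W" "w' \<in> W" "z = (u + w) + (v + w')"
    by (auto simp: elt_set_plus_def set_plus_def)
  then have "w + w' \<in> W" "z = (u + v) + (w + w')" using subspace_add[OF W] by (simp_all add: ac_simps)
  then show "z \<in> (u + v) +o W" unfolding elt_set_plus_def by blast
next
  fix z assume "z \<in> (u + v) +o W"
  then obtain w where w: "w \<in> W" "z = (u + w) + (v + 0)" by (auto simp: elt_set_plus_def ac_simps)
  have "u + w \<in> u +o W" "v + 0 \<in> v +o W" using w(1) subspace_0[OF W] unfolding elt_set_plus_def by blast+
  then show "z \<in> (u +o W) + (v +o W)" unfolding w(2) by (rule set_plus_intro)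
qed

lemma coset_scale:
  assumes W: "subspace W"
  shows "scale c ` (u +o W) + W = scale c u +o W"
proof (intro equalityI subsetI)
  fix x assume "x \<in> scale c ` (u +o W) + W"
  then obtain w w' where "w \<in> W" "w' \<in> W" "x = scale c (u + w) + w'"
    by (auto simp: elt_set_plus_def set_plus_def)
  then have "scale c w + w' \<in> W" "x = scale c u + (scale c w + w')"
    using subspace_add[OF W subspace_scale[OF W]] by (simp_all add: scale_right_distrib ac_simps)
  then show "x \<in> scale c u +o W" unfolding elt_set_plus_def by blast
next
  fix x assume "x \<in> scale c u +o W"
  then obtain w where w: "w \<in> W" "x = scale c (u + 0) + w" by (auto simp: elt_set_plus_def)
  have "scale c (u + 0) \<in> scale c ` (u +o W)" using subspace_0[OF W] unfolding elt_set_plus_def by blast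
  then show "x \<in> scale c ` (u +o W) + W" unfolding w(2) using w(1) by (rule set_plus_intro)
qed

lemma subspace_record_vectorspace:
  assumes U: "subspace U"
  shows "vectorspace class_ring (subspace_record scale U)"
proof -
  let ?Q = "subspace_record scale U"
  have grp: "abelian_group ?Q"
  proof (rule abelian_groupI)
    show "\<exists>y\<in>carrier ?Q. y \<oplus>\<^bsub>?Q\<^esub> x = \<zero>\<^bsub>?Q\<^esub>" if x: "x \<in> carrier ?Q" for x
      using x subspace_neg[OF U] by (intro bexI[of _ "- x"]) (simp_all add: subspace_record_def)
  qed (use subspace_add[OF U] subspace_0[OF U] in \<open>simp_all add: subspace_record_def ac_simps\<close>)
  have "Module.module class_ring ?Q"
  proof (rule Module.module.intro)
    show "cring (class_ring :: 'a ring)" by unfold_locales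
    show "abelian_group ?Q" by (rule grp)
    show "module_axioms class_ring ?Q"
      by (rule module_axioms.intro)
        (use subspace_scale[OF U] in
          \<open>simp_all add: subspace_record_def scale_left_distrib scale_right_distrib class_ring_simps\<close>)
  qed
  moreover have "field (class_ring :: 'a ring)" by unfold_locales
  ultimately show ?thesis by (rule vectorspace.intro)
qed

text \<open>The vectors whose coset lies in the span of the cosets of \<open>C\<close> form a
  subspace that contains \<open>C\<close> and \<open>W\<close>.\<close>

lemma quotient_fin_dim:
  assumes U: "subspace U" and W: "subspace W" and WU: "W \<subseteq> U"
    and C: "finite C" "C \<subseteq> U" "U \<subseteq> span (C \<union> W)"
  shows "vectorspace.fin_dim class_ring (quotient_record scale U W)"
proof -
  let ?Q = "quotient_record scale U W"
  interpret Q: vectorspace class_ring ?Q by (rule quotient_record_vectorspace[OF U W WU])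
  let ?C = "(\<lambda>u. u +o W) ` C"
  have CQ: "?C \<subseteq> carrier ?Q" using C(2) by (auto simp: quotient_record_def)
  interpret S: submodule class_ring "Q.span ?C" ?Q by (rule Q.span_is_submodule[OF CQ])
  have in_own: "?C \<subseteq> Q.span ?C" by (rule Q.in_own_span[OF CQ])
  have z: "w +o W = W" if "w \<in> W" for w
    using coset_eq_iff[OF W, of w 0] that by (simp add: elt_set_plus_def)
  let ?T = "{u. u +o W \<in> Q.span ?C}"
  have "subspace ?T"
  proof (rule subspaceI)
    show "0 \<in> ?T" using S.zero_closed z[OF subspace_0[OF W]] by (simp add: quotient_record_def)
    show "x + y \<in> ?T" if "x \<in> ?T" "y \<in> ?T" for x y
      using S.m_closed[of "x +o W" "y +o W"] that by (simp add: quotient_record_def coset_add[OF W])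
    show "scale c x \<in> ?T" if "x \<in> ?T" for c x
      using S.smult_closed[of c "x +o W"] that
      by (simp add: quotient_record_def coset_scale[OF W] class_ring_simps)
  qed
  moreover have "C \<union> W \<subseteq> ?T"
  proof (rule Un_least)
    show "C \<subseteq> ?T" using in_own by blast
    show "W \<subseteq> ?T" using S.zero_closed z by (auto simp: quotient_record_def)
  qed
  ultimately have "U \<subseteq> ?T" using span_minimal[of "C \<union> W" ?T] C(3) by blast
  then have "carrier ?Q \<subseteq> Q.span ?C" by (auto simp: quotient_record_def)
  then have "Q.span ?C = carrier ?Q" using S.subset by blast
  then show ?thesis unfolding Q.fin_dim_def using C(1) CQ by (intro exI[of _ ?C]) simp
qed

end

text \<open>The dimension is the least size of a finite spanning set; finite dimensionality provides
  a set of that size, and the empty set spans only zero.\<close>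

lemma dim_ge_1:
  assumes "vectorspace class_ring Q" "vectorspace.fin_dim class_ring Q"
    and x: "x \<in> carrier Q" "x \<noteq> \<zero>\<^bsub>Q\<^esub>"
  shows "vectorspace.dim class_ring Q \<ge> 1"
proof -
  interpret Q: vectorspace class_ring Q by (rule assms(1))
  let ?P = "\<lambda>n. \<exists>A. finite A \<and> card A = n \<and> A \<subseteq> carrier Q \<and> Q.span A = carrier Q"
  have "\<exists>n. ?P n" using assms(2) unfolding Q.fin_dim_def by blast
  then have "?P Q.dim" unfolding Q.dim_def by (rule LeastI_ex)
  then obtain A where A: "finite A" "card A = Q.dim" "Q.span A = carrier Q" by blast
  have "A \<noteq> {}"
  proof
    assume "A = {}"
    then have "Q.span A \<subseteq> {\<zero>\<^bsub>Q\<^esub>}" by (auto simp: Q.span_def Q.lincomb_def)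
    then show False using A(3) x by blast
  qed
  then show ?thesis using A(1,2) by (simp add: Suc_le_eq card_gt_0_iff flip: A(2))
qed

text \<open>\<open>\<Phi>\<close> maps \<open>E\<close> onto a complement of \<open>W\<close> in
  \<open>U\<close>. Used with the identity and W = {0} for the invariants, and with
  \<open>extend\<close> and the coboundaries for the adjoint cohomology.\<close>

lemma subspace_iso_quotient:
  assumes s1: "vector_space s1" and s2: "vector_space s2"
    and E: "Modules.module.subspace s1 E"
    and U: "Modules.module.subspace s2 U" and W: "Modules.module.subspace s2 W" and WU: "W \<subseteq> U"
    and add: "\<And>x y. x \<in> E \<Longrightarrow> y \<in> E \<Longrightarrow> \<Phi> (x + y) = \<Phi> x + \<Phi> y"
    and scale: "\<And>c x. x \<in> E \<Longrightarrow> \<Phi> (s1 c x) = s2 c (\<Phi> x)"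
    and cl: "\<And>x. x \<in> E \<Longrightarrow> \<Phi> x \<in> U"
    and onto: "\<And>u. u \<in> U \<Longrightarrow> \<exists>x\<in>E. u - \<Phi> x \<in> W"
    and inj: "\<And>x. x \<in> E \<Longrightarrow> \<Phi> x \<in> W \<Longrightarrow> x = 0"
  shows "vs_isomorphic (subspace_record s1 E) (quotient_record s2 U W)"
proof -
  interpret A: vector_space s1 by (rule s1)
  interpret B: vector_space s2 by (rule s2)
  show ?thesis
  proof (rule vs_isomorphicI[OF A.subspace_record_vectorspace[OF E] B.quotient_record_vectorspace[OF U W WU],
        of "\<lambda>x. \<Phi> x +o W"])
    show "\<Phi> x +o W \<in> carrier (quotient_record s2 U W)" if "x \<in> carrier (subspace_record s1 E)" for x
      using cl that by (simp add: quotient_record_def subspace_record_def)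
    show "\<Phi> (x \<oplus>\<^bsub>subspace_record s1 E\<^esub> y) +o W = (\<Phi> x +o W) \<oplus>\<^bsub>quotient_record s2 U W\<^esub> (\<Phi> y +o W)"
      if "x \<in> carrier (subspace_record s1 E)" "y \<in> carrier (subspace_record s1 E)" for x y
      using that by (simp add: quotient_record_def subspace_record_def B.coset_add[OF W] add)
    show "\<Phi> (c \<odot>\<^bsub>subspace_record s1 E\<^esub> x) +o W = c \<odot>\<^bsub>quotient_record s2 U W\<^esub> (\<Phi> x +o W)"
      if "x \<in> carrier (subspace_record s1 E)" for c x
      using that by (simp add: quotient_record_def subspace_record_def B.coset_scale[OF W] scale)
    have "inj_on (\<lambda>x. \<Phi> x +o W) E"
    proof (rule inj_onI)
      fix x y assume xy: "x \<in> E" "y \<in> E" "\<Phi> x +o W = \<Phi> y +o W"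
      have d: "x - y \<in> E" by (rule A.subspace_diff[OF E xy(1,2)])
      have "\<Phi> (x - y) = \<Phi> x - \<Phi> y" using add[OF d xy(2)] by simp
      then have "\<Phi> (x - y) \<in> W" using xy(3) by (simp add: B.coset_eq_iff[OF W])
      from inj[OF d this] show "x = y" by simp
    qed
    moreover have "(\<lambda>x. \<Phi> x +o W) ` E = (\<lambda>u. u +o W) ` U"
    proof (intro equalityI subsetI)
      fix z assume "z \<in> (\<lambda>u. u +o W) ` U"
      then obtain u where u: "u \<in> U" "z = u +o W" by blast
      obtain x where "x \<in> E" "u - \<Phi> x \<in> W" using onto[OF u(1)] by blast
      then show "z \<in> (\<lambda>x. \<Phi> x +o W) ` E" using u(2) B.coset_eq_iff[OF W, of u "\<Phi> x"] by blast
    qed (use cl in blast)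
    ultimately show "bij_betw (\<lambda>x. \<Phi> x +o W) (carrier (subspace_record s1 E)) (carrier (quotient_record s2 U W))"
      by (simp add: bij_betw_def quotient_record_def subspace_record_def)
  qed
qed

section \<open>Derivations of the semidirect product\<close>

context semisimple_module
begin

abbreviation sscale :: "complex \<Rightarrow> 'l \<times> 'm \<Rightarrow> 'l \<times> 'm" where
  "sscale \<equiv> semidirect_scale scl scaleM"

abbreviation sbracket :: "'l \<times> 'm \<Rightarrow> 'l \<times> 'm \<Rightarrow> 'l \<times> 'm" where
  "sbracket \<equiv> semidirect_bracket bracket act"

definition equivariant :: "('m \<Rightarrow> 'm) set" where
  "equivariant = {f. MO.endo f \<and> (\<forall>x v. f (act x v) = act x (f v))}"

definition extend :: "('m \<Rightarrow> 'm) \<Rightarrow> 'l \<times> 'm \<Rightarrow> 'l \<times> 'm" where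
  "extend f p = (0, f (snd p))"

interpretation G: lie_algebra sscale sbracket
  by (rule semidirect_lie_algebra)

interpretation P: vector_space_prod scl scaleM
  by unfold_locales

lemma sbracket_pair: "sbracket (x, v) (y, u) = (bracket x y, act x u - act y v)"
  by (simp add: semidirect_bracket_def)

lemma Z1_iff:
  "f \<in> ce_Z1 sscale sbracket sscale sbracket \<longleftrightarrow>
    Vector_Spaces.linear sscale sscale f \<and>
    (\<forall>p q. f (sbracket p q) = sbracket p (f q) - sbracket q (f p))"
  by (auto simp: ce_Z1_def ce_d1_def fun_eq_iff)

lemma derivation_decomposition:
  assumes f: "f \<in> ce_Z1 sscale sbracket sscale sbracket"
  shows "\<exists>a m. \<exists>d\<in>equivariant. \<forall>p. f p = sbracket p (a, m) + extend d p"
proof -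
  have lin: "f (p + q) = f p + f q" "f (sscale c p) = sscale c (f p)" for p q c
    using f unfolding Z1_iff Vector_Spaces.linear_iff by blast+
  have der: "f (sbracket p q) = sbracket p (f q) - sbracket q (f p)" for p q
    using f unfolding Z1_iff by blast
  define \<alpha> \<beta> \<gamma> \<delta> where "\<alpha> y = fst (f (y, 0))" and "\<beta> y = snd (f (y, 0))"
    and "\<gamma> u = fst (f (0, u))" and "\<delta> u = snd (f (0, u))" for y u
  have f1: "f (y, 0) = (\<alpha> y, \<beta> y)" and f2: "f (0, u) = (\<gamma> u, \<delta> u)" for y u
    by (simp_all add: \<alpha>_def \<beta>_def \<gamma>_def \<delta>_def)
  have a_lin: "Vector_Spaces.linear scl scl \<alpha>" "Vector_Spaces.linear scl scaleM \<beta>"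
    "Vector_Spaces.linear scaleM scl \<gamma>" "Vector_Spaces.linear scaleM scaleM \<delta>"
    unfolding Vector_Spaces.linear_iff
    using lin(1)[of "(_, 0)" "(_, 0)"] lin(2)[of _ "(_, 0)"] lin(1)[of "(0, _)" "(0, _)"] lin(2)[of _ "(0, _)"]
    by (simp_all add: f1 f2 P.scale_def vector_space_axioms M.vector_space_axioms)
  have ab: "\<alpha> (bracket y z) = bracket y (\<alpha> z) - bracket z (\<alpha> y)"
    "\<beta> (bracket y z) = act y (\<beta> z) - act z (\<beta> y)" for y z
    using der[of "(y, 0)" "(z, 0)"] by (simp_all add: sbracket_pair f1)
  have gd: "\<gamma> (act y u) = bracket y (\<gamma> u)" "\<delta> (act y u) = act y (\<delta> u) + act (\<alpha> y) u" for y u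
    using der[of "(y, 0)" "(0, u)"] by (simp_all add: sbracket_pair f1 f2)
  \<comment> \<open>Two vectors of \<open>V\<close> commute, so the derivation identity for them
    leaves only this symmetry.\<close>
  have gg: "act (\<gamma> u) v = act (\<gamma> v) u" for u v
  proof -
    have "\<delta> 0 = 0"
      using a_lin(4) by (rule MO.endo_zero)
    then show ?thesis
      using der[of "(0, v)" "(0, u)"] by (simp add: sbracket_pair f2)
  qed
  have S: "semisimple_module scl bracket B scl bracket B"
    by (intro semisimple_module.intro semisimple_lie_axioms ad.fd_lie_module_axioms)
  have "semisimple_module.cocycle scl bracket scl bracket \<alpha>"
    unfolding semisimple_module.cocycle_def[OF S] using a_lin(1) ab(1) by blast
  then obtain a where a: "\<And>y. \<alpha> y = bracket y a"
    using whitehead_first_lemma[OF S] by blast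
  have "cocycle \<beta>"
    unfolding cocycle_def using a_lin(2) ab(2) by blast
  then obtain m where m: "\<And>y. \<beta> y = act y m"
    using whitehead_first_lemma[OF semisimple_module_axioms] by blast
  have g_zero: "\<gamma> u = 0" for u
  proof -
    have g: "\<gamma> (u + v) = \<gamma> u + \<gamma> v" "\<gamma> (scaleM c u) = scl c (\<gamma> u)" for u v c
      using a_lin(3) by (simp_all add: Vector_Spaces.linear_iff)
    have "lie_ideal scl bracket (range \<gamma>)"
    proof (rule lie_idealI)
      show "subspace (range \<gamma>)"
      proof (rule subspaceI)
        show "0 \<in> range \<gamma>" using g(2)[of 0 0] by (metis rangeI scale_zero_left)
        show "x + y \<in> range \<gamma>" if "x \<in> range \<gamma>" "y \<in> range \<gamma>" for x y
          using that by (auto simp: g(1)[symmetric])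
        show "scl c x \<in> range \<gamma>" if "x \<in> range \<gamma>" for c x
          using that by (auto simp: g(2)[symmetric])
      qed
      show "bracket x y \<in> range \<gamma>" if "y \<in> range \<gamma>" for x y
        using that by (auto simp: gd(1)[symmetric])
    qed
    \<comment> \<open>The bracket of \<gamma> u and \<gamma> v is the \<gamma>-image of
      \<open>act (\<gamma> u) v\<close>, which is symmetric in u and v; a bracket that is symmetric
      and antisymmetric vanishes.\<close>
    moreover have "bracket x y = 0" if xy: "x \<in> range \<gamma>" "y \<in> range \<gamma>" for x y
    proof -
      obtain u v where uv: "x = \<gamma> u" "y = \<gamma> v" using xy by blast
      have "bracket x y = bracket y x"
        by (simp only: uv gd(1)[symmetric] gg[of u v])
      then have "bracket x y = - bracket x y" using bracket_anti[of y x] by metis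
      then have "scl 2 (bracket x y) = 0"
        using scale_left_distrib[of 1 1 "bracket x y"] by (simp add: eq_neg_iff_add_eq_0)
      then show ?thesis by simp
    qed
    ultimately have "range \<gamma> = {0}" by (rule abelian_ideal_zero)
    then show ?thesis by blast
  qed
  \<comment> \<open>The inner part \<open>sbracket p (a, m)\<close> contributes
    \<open>- act a u\<close> to the \<open>V\<close>-component. Adding it back cancels the defect
    \<open>act (\<alpha> y) u\<close> in the equivariance of \<delta>.\<close>
  define d where "d u = \<delta> u + act a u" for u
  have "MO.endo d"
    unfolding d_def by (rule MO.endo_plus[OF a_lin(4) endo_act])
  moreover have "d (act y u) = act y (d u)" for y u
    by (simp add: d_def gd(2) a act_bracket act_add)
  ultimately have "d \<in> equivariant" by (simp add: equivariant_def)
  moreover have "f p = sbracket p (a, m) + extend d p" for p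
  proof (cases p)
    case (Pair y u)
    have "f (y, u) = f (y, 0) + f (0, u)" using lin(1)[of "(y, 0)" "(0, u)"] by simp
    then show ?thesis
      by (simp add: Pair f1 f2 g_zero a m sbracket_pair extend_def d_def)
  qed
  ultimately show ?thesis by blast
qed

lemma extend_cocycle:
  assumes "d \<in> equivariant"
  shows "extend d \<in> ce_Z1 sscale sbracket sscale sbracket"
proof -
  have d: "d (u + v) = d u + d v" "d (scaleM c u) = scaleM c (d u)" "d (act x u) = act x (d u)"
    "d (u - v) = d u - d v" for u v c x
    using assms MO.endo_add[of d] MO.endo_scale[of d] MO.endo_diff[of d] by (auto simp: equivariant_def)
  have "Vector_Spaces.linear sscale sscale (extend d)"
    unfolding Vector_Spaces.linear_iff
    using G.vector_space_axioms by (simp add: extend_def d P.scale_def)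
  moreover have "extend d (sbracket p q) = sbracket p (extend d q) - sbracket q (extend d p)" for p q
    by (cases p; cases q) (simp add: extend_def sbracket_pair d)
  ultimately show ?thesis by (simp add: Z1_iff)
qed

lemma extend_inner_zero:
  assumes d: "\<And>p. extend d p = sbracket p (a, m)" and lin: "MO.endo d"
  shows "d = (\<lambda>u. 0)"
proof -
  have "bracket y a = 0" for y
    using d[of "(y, 0)"] by (simp add: extend_def sbracket_pair)
  then have "bracket a y = 0" for y using bracket_anti[of a y] by simp
  then have "a = 0" by (rule central_zero)
  then have "d u = 0" for u using d[of "(0, u)"] by (simp add: extend_def sbracket_pair)
  then show ?thesis by blast
qed

section \<open>Identification of the cohomology spaces\<close>

lemma module_endomorphisms_eq:
  "module_endomorphisms scaleM act = subspace_record (fun_scale scaleM) equivariant"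
  by (simp add: module_endomorphisms_def equivariant_def)

lemma B1_abelian: "ce_B1 (\<lambda>(v::'m) (u::'m). 0::'m) = {0}"
  by (auto simp: ce_B1_def ce_d0_def fun_eq_iff)

lemma Z1_abelian: "ce_Z1 scaleM (\<lambda>v u. 0) scaleM (\<lambda>v u. 0) = {f. MO.endo f}"
  using MO.endo_zero by (auto simp: ce_Z1_def ce_d1_def fun_eq_iff)

text \<open>For the abelian algebra with trivial action both differentials vanish on linear data, so
  classes are singletons, and invariance of a class is equivariance of its only
  representative.\<close>

lemma invariants_eq:
  "H1_abelian_invariants scaleM act = quotient_record (fun_scale scaleM) equivariant {0}"
proof -
  have act: "H1_abelian_act act x (f +o {0}) = {0} \<longleftrightarrow> (\<forall>v. f (act x v) = act x (f v))" for x f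
  proof -
    have "f +o {0} = {f}" by (auto simp: elt_set_plus_def)
    then have "H1_abelian_act act x (f +o {0}) = {cochain_act act x f}"
      by (simp add: H1_abelian_act_def B1_abelian set_plus_def)
    then show ?thesis by (auto simp: cochain_act_def fun_eq_iff)
  qed
  have "{A \<in> (\<lambda>u. u +o {0}) ` {f. MO.endo f}. \<forall>x. H1_abelian_act act x A = {0}}
      = (\<lambda>u. u +o {0}) ` equivariant"
    unfolding equivariant_def using act by auto
  then show ?thesis
    by (simp add: H1_abelian_invariants_def ce_H1_def quotient_record_def B1_abelian Z1_abelian)
qed

lemma vector_space_cochains: "vector_space (fun_scale scaleM :: complex \<Rightarrow> ('m \<Rightarrow> 'm) \<Rightarrow> _)"
  by (rule M.vector_space_fun)

lemma subspace_equivariant: "Modules.module.subspace (fun_scale scaleM) equivariant"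
proof -
  interpret F: vector_space "fun_scale scaleM :: complex \<Rightarrow> ('m \<Rightarrow> 'm) \<Rightarrow> _"
    by (rule vector_space_cochains)
  show ?thesis
    by (rule F.subspaceI)
      (auto simp: equivariant_def Vector_Spaces.linear_iff fun_scale_def act_add act_scale
        M.scale_right_distrib M.vector_space_axioms mult.commute)
qed

lemma endomorphisms_iso_invariants:
  "vs_isomorphic (module_endomorphisms scaleM act) (H1_abelian_invariants scaleM act)"
proof -
  interpret F: vector_space "fun_scale scaleM :: complex \<Rightarrow> ('m \<Rightarrow> 'm) \<Rightarrow> _"
    by (rule vector_space_cochains)
  show ?thesis
    unfolding module_endomorphisms_eq invariants_eq
    by (rule subspace_iso_quotient[where \<Phi> = "\<lambda>f. f"])
      (use F.subspace_0[OF subspace_equivariant] in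
        \<open>auto simp: vector_space_cochains subspace_equivariant F.subspace_single_0\<close>)
qed

lemma adjoint_cochains:
  shows vector_space_adjoint_cochains:
    "vector_space (fun_scale sscale :: complex \<Rightarrow> ('l \<times> 'm \<Rightarrow> 'l \<times> 'm) \<Rightarrow> _)"
    and subspace_Z1: "Modules.module.subspace (fun_scale sscale) (ce_Z1 sscale sbracket sscale sbracket)"
    and subspace_B1: "Modules.module.subspace (fun_scale sscale) (ce_B1 sbracket)"
    and B1_Z1: "ce_B1 sbracket \<subseteq> ce_Z1 sscale sbracket sscale sbracket"
proof -
  show vs: "vector_space (fun_scale sscale :: complex \<Rightarrow> ('l \<times> 'm \<Rightarrow> 'l \<times> 'm) \<Rightarrow> _)"
    by (rule G.vector_space_fun)
  interpret F: vector_space "fun_scale sscale :: complex \<Rightarrow> ('l \<times> 'm \<Rightarrow> 'l \<times> 'm) \<Rightarrow> _"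
    by (rule vs)
  have "f + g \<in> ce_Z1 sscale sbracket sscale sbracket"
    if "f \<in> ce_Z1 sscale sbracket sscale sbracket" "g \<in> ce_Z1 sscale sbracket sscale sbracket" for f g
    using that unfolding Z1_iff Vector_Spaces.linear_iff
    by (simp add: G.bracket_add G.scale_right_distrib)
  moreover have "fun_scale sscale c f \<in> ce_Z1 sscale sbracket sscale sbracket"
    if "f \<in> ce_Z1 sscale sbracket sscale sbracket" for c f
    using that unfolding Z1_iff Vector_Spaces.linear_iff
    by (simp add: fun_scale_def G.bracket_scale G.scale_right_distrib G.scale_right_diff_distrib mult.commute)
  moreover have "0 \<in> ce_Z1 sscale sbracket sscale sbracket"
    unfolding Z1_iff Vector_Spaces.linear_iff using G.vector_space_axioms by simp
  ultimately show "F.subspace (ce_Z1 sscale sbracket sscale sbracket)" by (intro F.subspaceI)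
  show "F.subspace (ce_B1 sbracket)"
  proof (rule F.subspaceI)
    show "0 \<in> ce_B1 sbracket"
      unfolding ce_B1_def ce_d0_def by (rule range_eqI[of _ _ 0]) (simp add: fun_eq_iff)
    show "f + g \<in> ce_B1 sbracket" if "f \<in> ce_B1 sbracket" "g \<in> ce_B1 sbracket" for f g
    proof -
      from that obtain m n where "f = ce_d0 sbracket m" "g = ce_d0 sbracket n" by (auto simp: ce_B1_def)
      then have "f + g = ce_d0 sbracket (m + n)" by (simp add: ce_d0_def fun_eq_iff G.bracket_add)
      then show ?thesis by (simp add: ce_B1_def)
    qed
    show "fun_scale sscale c f \<in> ce_B1 sbracket" if "f \<in> ce_B1 sbracket" for c f
    proof -
      from that obtain m where "f = ce_d0 sbracket m" by (auto simp: ce_B1_def)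
      then have "fun_scale sscale c f = ce_d0 sbracket (sscale c m)"
        by (simp add: ce_d0_def fun_scale_def fun_eq_iff G.bracket_scale)
      then show ?thesis by (simp add: ce_B1_def)
    qed
  qed
  interpret A: lie_module sscale sbracket sscale sbracket by (rule G.adjoint_lie_module)
  show "ce_B1 sbracket \<subseteq> ce_Z1 sscale sbracket sscale sbracket"
    using A.act_linear_left A.act_bracket by (auto simp: ce_B1_def ce_d0_def Z1_iff)
qed

lemma extend_in_B1:
  assumes "d \<in> equivariant" "extend d \<in> ce_B1 sbracket"
  shows "d = 0"
proof -
  obtain q where "extend d = ce_d0 sbracket q" using assms(2) by (auto simp: ce_B1_def)
  then have "extend d p = sbracket p (fst q, snd q)" for p by (simp add: ce_d0_def)
  moreover have "MO.endo d" using assms(1) by (simp add: equivariant_def)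
  ultimately have "d = (\<lambda>u. 0)" by (rule extend_inner_zero)
  then show ?thesis by (simp add: fun_eq_iff)
qed

lemma cocycle_mod_extend:
  assumes "f \<in> ce_Z1 sscale sbracket sscale sbracket"
  shows "\<exists>d\<in>equivariant. f - extend d \<in> ce_B1 sbracket"
proof -
  obtain a m d where d: "d \<in> equivariant" "\<And>p. f p = sbracket p (a, m) + extend d p"
    using derivation_decomposition[OF assms] by blast
  have "f - extend d = ce_d0 sbracket (a, m)" by (simp add: fun_eq_iff ce_d0_def d(2))
  then show ?thesis using d(1) by (auto simp: ce_B1_def)
qed

lemma endomorphisms_iso_H1:
  "vs_isomorphic (module_endomorphisms scaleM act) (H1_adjoint sscale sbracket)"
  unfolding module_endomorphisms_eq ce_H1_def
proof (rule subspace_iso_quotient[where \<Phi> = extend])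
  show "extend (d + e) = extend d + extend e" for d e
    by (simp add: fun_eq_iff extend_def)
  show "extend (fun_scale scaleM c d) = fun_scale sscale c (extend d)" for c d
    by (simp add: fun_eq_iff extend_def fun_scale_def P.scale_def)
qed (fact vector_space_cochains vector_space_adjoint_cochains subspace_equivariant
    subspace_Z1 subspace_B1 B1_Z1 extend_cocycle cocycle_mod_extend extend_in_B1)+

text \<open>The matrix units in \<open>T\<close> span all linear maps but need not be equivariant.
  They only bound the size of a maximal independent set of equivariant maps.\<close>

lemma equivariant_finite_span:
  obtains C where "finite C" "C \<subseteq> equivariant"
    "equivariant \<subseteq> Modules.module.span (fun_scale scaleM) C"
proof -
  interpret F: vector_space "fun_scale scaleM :: complex \<Rightarrow> ('m \<Rightarrow> 'm) \<Rightarrow> _"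
    by (rule vector_space_cochains)
  define T where "T = (\<lambda>(b, b') v. scaleM (M.representation BM v b) b') ` (BM \<times> BM)"
  have finT: "finite T" using MO.finite_Basis by (simp add: T_def)
  have eT: "f \<in> F.span T" if f: "f \<in> equivariant" for f
  proof -
    have lin: "MO.endo f" using f by (simp add: equivariant_def)
    have "f v = (\<Sum>p\<in>BM \<times> BM. fun_scale scaleM (M.representation BM (f (fst p)) (snd p))
        (\<lambda>v. scaleM (M.representation BM v (fst p)) (snd p))) v" for v
    proof -
      have "f v = (\<Sum>b\<in>BM. scaleM (M.representation BM v b) (f b))"
        by (subst MO.rep_expand[of v, symmetric]) (simp only: MO.endo_sum[OF lin] MO.endo_scale[OF lin])
      also have "\<dots> = (\<Sum>b\<in>BM. \<Sum>b'\<in>BM.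
          scaleM (M.representation BM (f b) b') (scaleM (M.representation BM v b) b'))"
        by (subst MO.rep_expand[of "f _", symmetric]) (simp add: M.scale_sum_right mult.commute)
      finally show ?thesis
        by (simp add: sum_fun_apply fun_scale_def sum.cartesian_product case_prod_beta)
    qed
    then have "f = (\<Sum>p\<in>BM \<times> BM. fun_scale scaleM (M.representation BM (f (fst p)) (snd p))
        (\<lambda>v. scaleM (M.representation BM v (fst p)) (snd p)))"
      by (rule ext)
    also have "\<dots> \<in> F.span T"
      by (intro F.span_sum F.span_scale F.span_base) (force simp: T_def)
    finally show ?thesis .
  qed
  obtain C where C: "C \<subseteq> equivariant" "F.independent C" "equivariant \<subseteq> F.span C"
    by (rule F.maximal_independent_subset)
  have "C \<subseteq> F.span T" using C(1) eT by blast
  then have "finite C" using F.independent_span_bound[OF finT C(2)] by blast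
  then show thesis using C(1,3) by (rule that)
qed

lemma H1_fin_dim: "vectorspace.fin_dim class_ring (H1_adjoint sscale sbracket)"
proof -
  interpret F: vector_space "fun_scale scaleM :: complex \<Rightarrow> ('m \<Rightarrow> 'm) \<Rightarrow> _"
    by (rule vector_space_cochains)
  interpret H: vector_space "fun_scale sscale :: complex \<Rightarrow> ('l \<times> 'm \<Rightarrow> 'l \<times> 'm) \<Rightarrow> _"
    by (rule vector_space_adjoint_cochains)
  obtain C where C: "finite C" "C \<subseteq> equivariant" "equivariant \<subseteq> F.span C"
    by (rule equivariant_finite_span)
  let ?S = "H.span (extend ` C \<union> ce_B1 sbracket)"
  have "F.subspace {d. extend d \<in> ?S}"
  proof (rule F.subspaceI)
    have "extend 0 = 0" by (simp add: fun_eq_iff extend_def zero_prod_def)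
    then show "0 \<in> {d. extend d \<in> ?S}" using H.span_zero by simp
    have "extend (d + e) = extend d + extend e" for d e by (simp add: fun_eq_iff extend_def)
    then show "d + e \<in> {d. extend d \<in> ?S}" if "d \<in> {d. extend d \<in> ?S}" "e \<in> {d. extend d \<in> ?S}" for d e
      using that H.span_add by simp
    have "extend (fun_scale scaleM c d) = fun_scale sscale c (extend d)" for c d
      by (simp add: fun_eq_iff extend_def fun_scale_def P.scale_def)
    then show "fun_scale scaleM c d \<in> {d. extend d \<in> ?S}" if "d \<in> {d. extend d \<in> ?S}" for c d
      using that H.span_scale by simp
  qed
  moreover have "C \<subseteq> {d. extend d \<in> ?S}" by (auto intro!: H.span_base)
  ultimately have ext: "equivariant \<subseteq> {d. extend d \<in> ?S}"
    using F.span_minimal[of C] C(3) by blast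
  show ?thesis
    unfolding ce_H1_def
  proof (rule H.quotient_fin_dim[OF subspace_Z1 subspace_B1 B1_Z1])
    show "finite (extend ` C)" using C(1) by simp
    show "extend ` C \<subseteq> ce_Z1 sscale sbracket sscale sbracket" using C(2) extend_cocycle by blast
    show "ce_Z1 sscale sbracket sscale sbracket \<subseteq> ?S"
    proof
      fix f assume "f \<in> ce_Z1 sscale sbracket sscale sbracket"
      then obtain d where d: "d \<in> equivariant" "f - extend d \<in> ce_B1 sbracket"
        using cocycle_mod_extend by blast
      have "extend d \<in> ?S" using ext d(1) by blast
      moreover have "f - extend d \<in> ?S" using d(2) by (intro H.span_base) blast
      ultimately have "extend d + (f - extend d) \<in> ?S" by (rule H.span_add)
      then show "f \<in> ?S" by simp
    qed
  qed
qed

section \<open>The identity of V as an outer derivation\<close>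

lemma id_equivariant: "(\<lambda>v. v) \<in> equivariant"
  using MO.endo_id by (simp add: equivariant_def)

text \<open>The witness is the class of the derivation that is zero on the semisimple part and the
  identity on \<open>V\<close>.\<close>

lemma H1_dim_ge_1:
  assumes "\<exists>v::'m. v \<noteq> 0"
  shows "vectorspace.dim class_ring (H1_adjoint sscale sbracket) \<ge> 1"
proof (rule dim_ge_1)
  interpret H: vector_space "fun_scale sscale :: complex \<Rightarrow> ('l \<times> 'm \<Rightarrow> 'l \<times> 'm) \<Rightarrow> _"
    by (rule vector_space_adjoint_cochains)
  let ?c = "extend (\<lambda>v. v) +o ce_B1 sbracket"
  show "vectorspace class_ring (H1_adjoint sscale sbracket)"
    unfolding ce_H1_def by (rule H.quotient_record_vectorspace[OF subspace_Z1 subspace_B1 B1_Z1])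
  show "vectorspace.fin_dim class_ring (H1_adjoint sscale sbracket)" by (rule H1_fin_dim)
  show "?c \<in> carrier (H1_adjoint sscale sbracket)"
    using extend_cocycle[OF id_equivariant] by (simp add: ce_H1_def quotient_record_def)
  show "?c \<noteq> \<zero>\<^bsub>H1_adjoint sscale sbracket\<^esub>"
  proof
    assume "?c = \<zero>\<^bsub>H1_adjoint sscale sbracket\<^esub>"
    then have "?c = 0 +o ce_B1 sbracket" by (simp add: ce_H1_def quotient_record_def elt_set_plus_def)
    then have "extend (\<lambda>v. v) - 0 \<in> ce_B1 sbracket"
      by (rule iffD1[OF H.coset_eq_iff[OF subspace_B1]])
    then have "extend (\<lambda>v. v) \<in> ce_B1 sbracket" by simp
    then have "(\<lambda>v::'m. v) = 0" by (rule extend_in_B1[OF id_equivariant])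
    then show False using assms by (metis zero_fun_apply)
  qed
qed

lemma not_complete:
  assumes "\<exists>v::'m. v \<noteq> 0"
  shows "\<not> complete_lie_algebra sscale sbracket"
proof
  assume c: "complete_lie_algebra sscale sbracket"
  have "extend (\<lambda>v. v) \<in> ce_Z1 sscale sbracket sscale sbracket"
    by (rule extend_cocycle[OF id_equivariant])
  then have "Vector_Spaces.linear sscale sscale (extend (\<lambda>v. v))"
    "\<And>p q. extend (\<lambda>v. v) (sbracket p q) = sbracket p (extend (\<lambda>v. v) q) - sbracket q (extend (\<lambda>v. v) p)"
    by (simp_all only: Z1_iff)
  moreover have "- sbracket q p = sbracket p q" for p q using G.bracket_anti[of p q] by simp
  ultimately have "derivation sscale sbracket (extend (\<lambda>v. v))"
    unfolding derivation_def by (metis add.commute diff_conv_add_uminus)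
  then obtain q where q: "extend (\<lambda>v. v) = sbracket q"
    using c unfolding complete_lie_algebra_def by blast
  \<comment> \<open>An inner derivation brackets with \<open>q\<close> on the left, a coboundary on
    the right; hence the sign.\<close>
  have "extend (\<lambda>v. v) p = ce_d0 sbracket (- q) p" for p
    by (simp only: q ce_d0_def G.bracket_neg) (rule G.bracket_anti)
  then have "extend (\<lambda>v. v) = ce_d0 sbracket (- q)" by (rule ext)
  then have "extend (\<lambda>v. v) \<in> ce_B1 sbracket" by (simp add: ce_B1_def)
  then have "(\<lambda>v::'m. v) = 0" by (rule extend_in_B1[OF id_equivariant])
  then show False using assms by (metis zero_fun_apply)
qed

end

theorem proposition3p1:
  fixes scaleS :: "complex \<Rightarrow> 's::ab_group_add \<Rightarrow> 's"
    and bracketS :: "'s \<Rightarrow> 's \<Rightarrow> 's"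
    and scaleV :: "complex \<Rightarrow> 'v::ab_group_add \<Rightarrow> 'v"
    and act :: "'s \<Rightarrow> 'v \<Rightarrow> 'v"
  assumes "semisimple_lie_algebra scaleS bracketS"
    and "\<exists>B. finite_dimensional_vector_space scaleS B"
    and "lie_module scaleS bracketS scaleV act"
    and "\<exists>B. finite_dimensional_vector_space scaleV B"
    and "\<exists>v::'v. v \<noteq> 0"
  shows "vs_isomorphic
           (H1_adjoint (semidirect_scale scaleS scaleV) (semidirect_bracket bracketS act))
           (H1_abelian_invariants scaleV act) \<and>
         vs_isomorphic (H1_abelian_invariants scaleV act) (module_endomorphisms scaleV act) \<and>
         vectorspace.fin_dim class_ring
           (H1_adjoint (semidirect_scale scaleS scaleV) (semidirect_bracket bracketS act)) \<and>
         vectorspace.dim class_ring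
           (H1_adjoint (semidirect_scale scaleS scaleV) (semidirect_bracket bracketS act)) \<ge> 1 \<and>
         \<not> complete_lie_algebra (semidirect_scale scaleS scaleV) (semidirect_bracket bracketS act)"
proof -
  obtain BS where BS: "finite_dimensional_vector_space scaleS BS" using assms(2) by blast
  obtain BV where BV: "finite_dimensional_vector_space scaleV BV" using assms(4) by blast
  interpret lie_module scaleS bracketS scaleV act by (rule assms(3))
  have S: "complex_fd_operators scaleS BS" and V: "complex_fd_operators scaleV BV"
    by (intro complex_fd_operators.intro complex_operators.intro fd_operators.intro operators.intro
        BS BV L.vector_space_axioms M.vector_space_axioms)+
  have "semisimple_lie scaleS bracketS BS"
    by (intro semisimple_lie.intro semisimple_lie_axioms.intro S L.lie_algebra_axioms)
      (use assms(1) in \<open>auto simp: semisimple_lie_algebra_def\<close>)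
  then interpret semisimple_module scaleS bracketS BS scaleV act BV
    by (intro semisimple_module.intro fd_lie_module.intro assms(3) S V)
  have "vs_isomorphic (H1_adjoint (semidirect_scale scaleS scaleV) (semidirect_bracket bracketS act))
      (H1_abelian_invariants scaleV act)"
    by (rule vs_isomorphic_trans[OF vs_isomorphic_sym[OF endomorphisms_iso_H1] endomorphisms_iso_invariants])
  then show ?thesis
    using vs_isomorphic_sym[OF endomorphisms_iso_invariants] H1_fin_dim
      H1_dim_ge_1[OF assms(5)] not_complete[OF assms(5)] by blast
qed

end
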